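(* Let $d\geq3$ be an integer, and let $\mathcal D\subset\mathbb{R}_{\geq0}^d$ be a bounded set with nonempty interior. Then there is a constant $C>0$ which depends only on $d$ and $\mathcal D$ such that $$\widetilde P_d(T,R)\leq C\,R^{-(d-1)}$$ for all $T>0$ with $\widehat{\mathbb{N}}^d\cap T\mathcal D\neq\emptyset$ and all $R>0$. Furthermore, for any such $T$, $$\widetilde P_d(T,R)=0\qquad\text{whenever } R\geq\Bigl(T\sup_{\boldsymbol x\in\mathcal D}\|\boldsymbol x\|\Bigr)^{1-\frac1{d-1}}.$$
   Context: $\widehat{\mathbb{N}}^d$ is the set of vectors $\boldsymbol a=(a_1,\ldots,a_d)$ with positive integer coefficients whose greatest common divisor is $1$. For $\boldsymbol a\in\widehat{\mathbb{N}}^d$, the Frobenius number $g(\boldsymbol a)$ is the largest integer which is not representable as a non-negative integer linear combination of $a_1,\ldots,a_d$, and $f(\boldsymbol a)=g(\boldsymbol a)+a_1+\cdots+a_d$. $\|\cdot\|$ is the standard Euclidean norm. Set $$s(\boldsymbol a)=\frac{\sum_{j=1}^d a_j\sqrt{\|\boldsymbol a\|^2-a_j^2}}{\|\boldsymbol a\|^{1-1/(d-1)}}.$$ For $R>0$ and $T>0$ with $\widehat{\mathbb{N}}^d\cap T\mathcal D\neq\emptyset$, define $$\widetilde P_d(T,R)=\frac{\#\bigl\{\boldsymbol a\in\widehat{\mathbb{N}}^d\cap T\mathcal D : f(\boldsymbol a)/s(\boldsymbol a)>R\bigr\}}{\#(\widehat{\mathbb{N}}^d\cap T\mathcal D)}.$$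 *)

theory Defs
  imports "HOL-Analysis.Analysis"
begin

definition primitive_vectors :: "(nat ^ 'n) set" where
  "primitive_vectors = {a. (\<forall>i. a $ i > 0) \<and> Gcd (range (\<lambda>i. a $ i)) = 1}"

definition real_vec :: "nat ^ 'n \<Rightarrow> real ^ 'n" where
  "real_vec a = (\<chi> i. real (a $ i))"

definition representable :: "nat ^ 'n::finite \<Rightarrow> int \<Rightarrow> bool" where
  "representable a m \<longleftrightarrow> (\<exists>k :: nat ^ 'n. m = (\<Sum>i\<in>UNIV. int (k $ i) * int (a $ i)))"

text \<open>The largest \<^emph>\<open>integer\<close> that is not representable: it is \<open>- 1\<close> if some entry of \<open>a\<close> is \<open>1\<close>.
  For vectors that are not primitive a largest such integer need not exist, and the value is then
  unspecified.\<close>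

definition frobenius_number :: "nat ^ 'n::finite \<Rightarrow> int" where
  "frobenius_number a = (GREATEST m. \<not> representable a m)"

definition frobenius_f :: "nat ^ 'n::finite \<Rightarrow> int" where
  "frobenius_f a = frobenius_number a + (\<Sum>i\<in>UNIV. int (a $ i))"

definition frobenius_s :: "nat ^ 'n::finite \<Rightarrow> real" where
  "frobenius_s a =
     (\<Sum>j\<in>UNIV. real (a $ j) * sqrt ((norm (real_vec a))\<^sup>2 - (real (a $ j))\<^sup>2))
       / norm (real_vec a) powr (1 - 1 / (real CARD('n) - 1))"

definition primitive_points :: "(real ^ 'n) set \<Rightarrow> real \<Rightarrow> (nat ^ 'n) set" where
  "primitive_points D T = {a \<in> primitive_vectors. real_vec a \<in> (\<lambda>x. T *\<^sub>R x) ` D}"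

definition tail_prob :: "(real ^ 'n::finite) set \<Rightarrow> real \<Rightarrow> real \<Rightarrow> real" where
  "tail_prob D T R =
     real (card {a \<in> primitive_points D T. real_of_int (frobenius_f a) / frobenius_s a > R})
       / real (card (primitive_points D T))"

end

theory Submission
  imports Defs
begin

text \<open>The vanishing statement is Schur's bound: if \<open>q\<close> is the largest and \<open>A\<close> the second largest
  entry of \<open>a\<close>, every residue modulo \<open>q\<close> is a sum of at most \<open>q - 1\<close> of the other entries, so
  \<open>f a \<le> (q - 1) * A\<close> plus the sum of the other entries, which is at most the numerator of \<open>s a\<close>.

  For the tail bound put \<open>n = d - 1\<close>. If \<open>f a > R * s a\<close>, then sums of the other entries with
  coefficients up to \<open>M\<close>, of order \<open>R * norm a powr (1/n)\<close>, miss some residue modulo \<open>q\<close>. By an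
  exponential sum argument there is then some \<open>0 < h < q\<close> for which all \<open>h * a i / q\<close> are within
  \<open>O(1 / M)\<close> of integers: otherwise the points \<open>(h * a i / q)\<close> are well separated on the torus, and
  the nontrivial frequencies cannot cancel the main term. Rounding gives an integer vector \<open>m\<close>, not
  parallel to \<open>a\<close> and no longer than \<open>a\<close>, such that \<open>a\<close> and \<open>m\<close> span a parallelogram of area
  \<open>O(T powr (1 - 1/n) / R)\<close>. Replacing \<open>a, m\<close> by a Gauss reduced basis of the lattice they span and
  counting reduced bases dyadically by their lengths shows that at most
  \<open>O(T\<^sup>2 * (T powr (1 - 1/n) / R) ^ n) = O(T ^ d / R ^ n)\<close> vectors \<open>a\<close> have this property, while there are
  at least \<open>c * T ^ d\<close> primitive vectors in total.\<close>

section \<open>Exponential sums and residues represented by boxes\<close>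

definition unit_char :: "real \<Rightarrow> complex" where
  "unit_char t = cis (2 * pi * t)"

lemma unit_char_add: "unit_char (s + t) = unit_char s * unit_char t"
  by (simp add: unit_char_def cis_mult algebra_simps)

lemma unit_char_of_int [simp]: "unit_char (of_int k) = 1"
  unfolding unit_char_def using cis_multiple_2pi[of "of_int k"] by simp

lemma norm_unit_char [simp]: "norm (unit_char t) = 1"
  by (simp add: unit_char_def)

lemma unit_char_power: "unit_char (real x * t) = unit_char t ^ x"
  using Complex.DeMoivre[of "2 * pi * t" x] by (simp add: unit_char_def mult.left_commute)

lemma unit_char_sum: "finite I \<Longrightarrow> unit_char (\<Sum>i\<in>I. f i) = (\<Prod>i\<in>I. unit_char (f i))"
  by (induction rule: finite_induct) (simp_all add: unit_char_add, simp add: unit_char_def)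

lemma unit_char_diff_int: "unit_char (t - of_int k) = unit_char t"
  using unit_char_add[of "t - of_int k" "of_int k"] by simp

text \<open>A weak form of Jordan's inequality: the cubic Taylor remainder is at most
  \<open>x / 2\<close> because \<open>x * x \<le> 3\<close> on this interval.\<close>

lemma sin_ge_half:
  fixes x :: real
  assumes "0 \<le> x" "x \<le> pi / 2"
  shows "x / 2 \<le> sin x"
proof -
  have "\<bar>sin x - x\<bar> \<le> x ^ 3 / 6"
    using Maclaurin_sin_bound[of x 3] assms
    by (simp add: numeral_3_eq_3 sin_coeff_def fact_numeral divide_simps)
  moreover have "x ^ 3 / 6 \<le> x / 2"
  proof -
    have "x \<le> 1.6" using assms pi_approx by simp
    hence "x * x \<le> 1.6 * 1.6" using assms by (intro mult_mono) auto
    hence "x * (x * x) \<le> x * 3" using assms by (intro mult_left_mono) auto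
    thus ?thesis by (simp add: power3_eq_cube algebra_simps)
  qed
  ultimately show ?thesis by linarith
qed

lemma norm_unit_char_minus_one_ge:
  assumes "\<bar>t\<bar> \<le> 1 / 2"
  shows "norm (unit_char t - 1) \<ge> 2 * \<bar>t\<bar>"
proof -
  have "norm (unit_char t - 1) = 2 * \<bar>sin (pi * t)\<bar>"
    using dist_exp_i_1[of "2 * pi * t"] by (simp add: unit_char_def cis_conv_exp mult.commute)
  also have "\<bar>sin (pi * t)\<bar> = \<bar>sin (pi * \<bar>t\<bar>)\<bar>" by (simp add: abs_if)
  also have "\<dots> \<ge> pi * \<bar>t\<bar> / 2"
    using sin_ge_half[of "pi * \<bar>t\<bar>"] assms by (simp add: mult_left_le)
  moreover have "pi * \<bar>t\<bar> / 2 \<ge> \<bar>t\<bar>" using mult_right_mono[OF pi_ge_two, of "\<bar>t\<bar>"] by simp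
  ultimately show ?thesis by linarith
qed

lemma norm_dirichlet_le:
  "norm (\<Sum>x<M. unit_char (real x * t)) \<le> real M"
  using norm_sum[of "\<lambda>x. unit_char (real x * t)" "{..<M}"] by simp

text \<open>The geometric sum times \<open>unit_char t - 1\<close> telescopes to a difference of two
  unit vectors, of norm at most 2, while \<open>norm (unit_char t - 1)\<close> is at least twice the
  distance from \<open>t\<close> to the nearest integer.\<close>

lemma norm_dirichlet_mult_le:
  "norm (\<Sum>x<M. unit_char (real x * t)) * \<bar>t - of_int (round t)\<bar> \<le> 1"
proof -
  define u where "u = t - of_int (round t)"
  have u: "\<bar>u\<bar> \<le> 1 / 2" using of_int_round_abs_le[of t] by (simp add: u_def abs_minus_commute)
  let ?S = "\<Sum>x<M. unit_char (real x * t)"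
  have "?S = (\<Sum>x<M. unit_char t ^ x)" by (simp add: unit_char_power)
  hence "(unit_char t - 1) * ?S = unit_char t ^ M - 1"
    by (simp add: power_diff_1_eq)
  hence "norm (unit_char t - 1) * norm ?S = norm (unit_char t ^ M - 1)"
    by (metis norm_mult)
  also have "\<dots> \<le> 2" using norm_triangle_ineq4[of "unit_char t ^ M" 1] by (simp add: norm_power)
  finally have 1: "norm (unit_char t - 1) * norm ?S \<le> 2" .
  have "2 * \<bar>u\<bar> \<le> norm (unit_char t - 1)"
    using norm_unit_char_minus_one_ge[OF u] by (simp add: u_def unit_char_diff_int)
  hence "(2 * \<bar>u\<bar>) * norm ?S \<le> norm (unit_char t - 1) * norm ?S"
    by (intro mult_right_mono) auto
  with 1 show ?thesis unfolding u_def by (simp add: mult.commute)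
qed

text \<open>Orthogonality of characters: a \<open>q\<close>-th root of unity other than 1 has
  vanishing geometric sum.\<close>

lemma sum_unit_char_eq_0:
  assumes "q > 0" "\<not> int q dvd s"
  shows "(\<Sum>h<q. unit_char (real h * (of_int s / real q))) = 0"
proof -
  let ?t = "of_int s / real q"
  have "unit_char ?t \<noteq> 1"
  proof
    assume "unit_char ?t = 1"
    hence "cis (2 * pi * ?t) = 1" by (simp add: unit_char_def)
    hence "cos (2 * pi * ?t) = 1" by (simp add: complex_eq_iff)
    then obtain k :: int where "2 * pi * ?t = of_int k * 2 * pi"
      using cos_one_2pi_int by blast
    hence "2 * pi * ?t = 2 * pi * of_int k" by simp
    hence "?t = of_int k" using mult_cancel_left[of "2 * pi" ?t "of_int k"] by (simp del: times_divide_eq_right)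
    hence "of_int s = (of_int (k * int q) :: real)" using assms by (simp add: field_simps)
    hence "s = k * int q" by (simp only: of_int_eq_iff)
    thus False using assms by simp
  qed
  moreover have "(unit_char ?t - 1) * (\<Sum>h<q. unit_char ?t ^ h) = unit_char ?t ^ q - 1"
    by (simp add: power_diff_1_eq)
  moreover have "unit_char ?t ^ q = unit_char (real q * ?t)" by (simp only: unit_char_power)
  moreover have "unit_char (real q * ?t) = 1" using assms by simp
  ultimately have "(\<Sum>h<q. unit_char ?t ^ h) = 0" by simp
  thus ?thesis by (simp only: unit_char_power)
qed

text \<open>Telescoping from \<open>1 / v^2 \<le> 1 / (v - 1) - 1 / v\<close>; the subtracted term
  carries the induction.\<close>

lemma sum_inverse_squares_le: "(\<Sum>v=1..m. 1 / (real v)\<^sup>2) \<le> 2 - 1 / real (max 1 m)"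
proof (induction m)
  case (Suc m)
  show ?case
  proof (cases "m = 0")
    case False
    have "1 / (real (Suc m))\<^sup>2 \<le> 1 / real m - 1 / real (Suc m)"
      using False by (simp add: divide_simps power2_eq_square)
    thus ?thesis using Suc False by (simp add: max_def split: if_splits)
  qed simp
qed simp

lemma sum_int_inverse_squares_le:
  fixes c :: real
  assumes "c \<ge> 0"
  shows "(\<Sum>v\<in>{-int m..int m}. if v = 0 then 1 else c / (of_int v)\<^sup>2) \<le> 1 + 4 * c"
proof -
  let ?f = "\<lambda>v::int. if v = 0 then 1 else c / (of_int v)\<^sup>2"
  have s: "{-int m..int m} = {0} \<union> int ` {1..m} \<union> (\<lambda>v. - int v) ` {1..m}"
  proof (intro equalityI subsetI)
    fix v assume v: "v \<in> {-int m..int m}"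
    show "v \<in> {0} \<union> int ` {1..m} \<union> (\<lambda>v. - int v) ` {1..m}"
    proof (cases "v \<ge> 0")
      case True
      then obtain k where "v = int k" using nonneg_int_cases by blast
      thus ?thesis using v by (cases "k = 0") auto
    next
      case False
      then obtain k where "v = - int k" using int_cases2 by (metis nle_le of_nat_0_le_iff)
      thus ?thesis using v by (cases "k = 0") auto
    qed
  qed auto
  have "sum ?f {-int m..int m} = 1 + sum ?f (int ` {1..m}) + sum ?f ((\<lambda>v. - int v) ` {1..m})"
    unfolding s by (subst sum.union_disjoint; (subst sum.union_disjoint)?) auto
  also have "sum ?f (int ` {1..m}) = c * (\<Sum>v=1..m. 1 / (real v)\<^sup>2)"
    by (subst sum.reindex) (auto simp: sum_distrib_left inj_on_def intro!: sum.cong)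
  also have "sum ?f ((\<lambda>v. - int v) ` {1..m}) = c * (\<Sum>v=1..m. 1 / (real v)\<^sup>2)"
    by (subst sum.reindex) (auto simp: sum_distrib_left inj_on_def intro!: sum.cong)
  finally have eq: "sum ?f {-int m..int m} = 1 + 2 * (c * (\<Sum>v=1..m. 1 / (real v)\<^sup>2))" by simp
  have "(\<Sum>v=1..m. 1 / (real v)\<^sup>2) \<le> 2" using sum_inverse_squares_le[of m]
    by (smt (verit, del_insts) divide_nonneg_nonneg of_nat_0_le_iff)
  from mult_left_mono[OF this assms] show ?thesis unfolding eq by linarith
qed

text \<open>Fixes the constant \<open>8 * n\<close> of the covering lemma: with cells of side
  \<open>8 * n / M\<close>, one coordinate carries total weight at most
  \<open>1 + 4 * (4 / (8 * n)^2)\<close>, and the product over \<open>n\<close> coordinates must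
  stay below 2.\<close>

lemma one_plus_power_lt_2:
  assumes "n > 0"
  shows "(1 + 4 * (4 / (8 * real n)\<^sup>2)) ^ n < (2::real)"
proof -
  have "(1 + 4 * (4 / (8 * real n)\<^sup>2)) ^ n \<le> exp (4 * (4 / (8 * real n)\<^sup>2)) ^ n"
    by (intro power_mono) auto
  also have "\<dots> = exp (real n * (4 * (4 / (8 * real n)\<^sup>2)))" by (simp only: exp_of_nat_mult)
  also have "real n * (4 * (4 / (8 * real n)\<^sup>2)) = 1 / (4 * real n)"
    using assms by (simp add: power2_eq_square field_simps)
  also have "exp (1 / (4 * real n)) \<le> exp (1/2)" using assms by (simp add: field_simps)
  also have "exp (1/2) < (2::real)"
  proof (rule power2_less_imp_less)
    have "(exp (1/2))\<^sup>2 = exp (1::real)" by (simp add: exp_double[symmetric])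
    thus "(exp (1/2))\<^sup>2 < (2::real)\<^sup>2" using exp_le by simp
  qed simp
  finally show ?thesis .
qed

lemma round_mem_int_interval:
  fixes x :: real
  assumes "\<bar>x\<bar> \<le> real L"
  shows "round x \<in> {-int L..int L}"
proof -
  have x: "x \<le> real L" "of_int (- int L) \<le> x" using assms by (simp_all add: abs_le_iff)
  show ?thesis
    using round_mono[OF x(1)] round_mono[OF x(2)] by (simp only: round_of_nat round_of_int) auto
qed

text \<open>If \<open>r\<close> is missed, Fourier inversion modulo \<open>q\<close> makes the
  \<open>q\<close> terms built from squared Dirichlet kernels sum to 0. The hypothesis
  \<open>far\<close> puts the frequencies into distinct cells of a grid on the torus, and the
  squared kernels decay quadratically in the cell index, so the terms with \<open>h > 0\<close> are
  together smaller than the term \<open>h = 0\<close>.\<close>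

lemma residues_covered_by_box:
  fixes a :: "'i \<Rightarrow> int" and q M :: nat and r :: int
  assumes fin: "finite I" and I: "card I > 0" and q: "q > 0" and M: "M > 0"
    and far: "\<And>h. 0 < h \<Longrightarrow> h < q \<Longrightarrow>
      \<exists>i\<in>I. 8 * real (card I) / real M <
        \<bar>real h * (of_int (a i) / real q) - of_int (round (real h * (of_int (a i) / real q)))\<bar>"
  shows "\<exists>z :: 'i \<Rightarrow> nat. (\<forall>i\<in>I. z i \<le> 2 * M - 2) \<and> int q dvd (\<Sum>i\<in>I. int (z i) * a i) - r"
proof (rule ccontr)
  assume no: "\<not> ?thesis"
  define K where "K = 8 * real (card I)"
  define t where "t h i = real h * (of_int (a i) / real q)" for h :: nat and i
  define D where "D h i = (\<Sum>x<M. unit_char (real x * t h i))" for h i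
  define B where "B = (PiE I (\<lambda>_. {..<M}) :: ('i \<Rightarrow> nat) set)"
  define e where "e h = unit_char (- (real h * (of_int r / real q)))" for h :: nat
  have K: "K > 0" using I by (simp add: K_def)
  have prodD: "(\<Sum>x\<in>B. \<Prod>i\<in>I. unit_char (real (x i) * t h i)) = (\<Prod>i\<in>I. D h i)" for h
    unfolding B_def D_def by (rule prod_sum_PiE[OF fin, of "\<lambda>_. {..<M}" "\<lambda>i x. unit_char (real x * t h i)", symmetric]) simp
  \<comment> \<open>Up to the factor \<open>q\<close>, the left side counts pairs
    \<open>x, y\<close> in \<open>B\<close> for which \<open>z = x + y\<close> hits the residue
    \<open>r\<close>. Taking two box points instead of one squares the kernels, which makes their
    decay summable, and explains the range up to \<open>2 * M - 2\<close>.\<close>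
  have zero: "(\<Sum>h<q. e h * (\<Prod>i\<in>I. D h i) * (\<Prod>i\<in>I. D h i)) = 0"
  proof -
    have z0: "(\<Sum>h<q. unit_char (real h * (of_int ((\<Sum>i\<in>I. int (x i + y i) * a i) - r) / real q))) = 0"
      if xy: "x \<in> B" "y \<in> B" for x y
    proof -
      have "\<forall>i\<in>I. x i + y i \<le> 2 * M - 2"
      proof
        fix i assume "i \<in> I"
        hence "x i < M" "y i < M" using xy by (auto simp: B_def)
        thus "x i + y i \<le> 2 * M - 2" by linarith
      qed
      hence "\<not> int q dvd (\<Sum>i\<in>I. int (x i + y i) * a i) - r"
        using no[unfolded not_ex, rule_format, of "\<lambda>i. x i + y i"] by blast
      thus ?thesis by (rule sum_unit_char_eq_0[OF q])
    qed
    have "0 = (\<Sum>x\<in>B. \<Sum>y\<in>B. \<Sum>h<q. unit_char (real h * (of_int ((\<Sum>i\<in>I. int (x i + y i) * a i) - r) / real q)))"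
      by (rule sum.neutral[symmetric], intro ballI sum.neutral z0)
    also have "\<dots> = (\<Sum>x\<in>B. \<Sum>y\<in>B. \<Sum>h<q. e h * (\<Prod>i\<in>I. unit_char (real (x i) * t h i)) *
        (\<Prod>i\<in>I. unit_char (real (y i) * t h i)))"
    proof (intro sum.cong refl)
      fix x y :: "'i \<Rightarrow> nat" and h :: nat
      have lin: "(\<Sum>i\<in>I. real (x i) * t h i) = real h * ((\<Sum>i\<in>I. real (x i) * of_int (a i)) / real q)" for x
        by (simp add: t_def sum_distrib_left sum_divide_distrib mult_ac)
      have "of_int (\<Sum>i\<in>I. int (x i + y i) * a i) =
          (\<Sum>i\<in>I. real (x i) * of_int (a i)) + (\<Sum>i\<in>I. real (y i) * of_int (a i))"
        by (simp add: sum.distrib ring_distribs)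
      hence "real h * (of_int ((\<Sum>i\<in>I. int (x i + y i) * a i) - r) / real q) =
          - (real h * (of_int r / real q)) + (\<Sum>i\<in>I. real (x i) * t h i) + (\<Sum>i\<in>I. real (y i) * t h i)"
        by (simp only: lin of_int_diff) (simp add: algebra_simps add_divide_distrib diff_divide_distrib)
      thus "unit_char (real h * (of_int ((\<Sum>i\<in>I. int (x i + y i) * a i) - r) / real q)) =
        e h * (\<Prod>i\<in>I. unit_char (real (x i) * t h i)) * (\<Prod>i\<in>I. unit_char (real (y i) * t h i))"
        by (simp only: unit_char_add unit_char_sum[OF fin] e_def)
    qed
    also have "\<dots> = (\<Sum>x\<in>B. \<Sum>h<q. \<Sum>y\<in>B. e h * (\<Prod>i\<in>I. unit_char (real (x i) * t h i)) *
        (\<Prod>i\<in>I. unit_char (real (y i) * t h i)))"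
      by (intro sum.cong refl sum.swap)
    also have "\<dots> = (\<Sum>h<q. \<Sum>x\<in>B. \<Sum>y\<in>B. e h * (\<Prod>i\<in>I. unit_char (real (x i) * t h i)) *
        (\<Prod>i\<in>I. unit_char (real (y i) * t h i)))"
      by (rule sum.swap)
    also have "\<dots> = (\<Sum>h<q. e h * (\<Prod>i\<in>I. D h i) * (\<Prod>i\<in>I. D h i))"
      by (simp only: prodD[symmetric] mult.assoc sum_product) (simp only: sum_distrib_left)
    finally show ?thesis by simp
  qed

  \<comment> \<open>\<open>v h\<close> is the index of the cell of side \<open>K / M\<close> around
    \<open>\<phi> h\<close>, and \<open>w\<close> majorises \<open>norm (D h i)^2 / M^2\<close> on a
    cell: for an index \<open>u \<noteq> 0\<close> the distance
    \<open>\<bar>\<phi> h i\<bar>\<close> is at least \<open>K * \<bar>u\<bar> / (2 * M)\<close>, so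
    the kernel is at most \<open>2 * M / (K * \<bar>u\<bar>)\<close>.\<close>
  define \<phi> where "\<phi> h i = t h i - of_int (round (t h i))" for h i
  define v where "v h = (\<lambda>i\<in>I. round (real M / K * \<phi> h i))" for h
  define w where "w u = (if u = 0 then 1 else (4 / K\<^sup>2) / (of_int u)\<^sup>2)" for u :: int
  have wnn: "w u \<ge> 0" for u by (simp add: w_def)
  have v_close: "\<bar>\<phi> h i - K / real M * of_int (v h i)\<bar> \<le> K / real M / 2" if "i \<in> I" for h i
  proof -
    have "\<bar>of_int (v h i) - real M / K * \<phi> h i\<bar> \<le> 1 / 2"
      using of_int_round_abs_le[of "real M / K * \<phi> h i"] that by (simp add: v_def)
    hence "K / real M * \<bar>of_int (v h i) - real M / K * \<phi> h i\<bar> \<le> K / real M * (1 / 2)"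
      using K M by (intro mult_left_mono) auto
    also have "K / real M * \<bar>of_int (v h i) - real M / K * \<phi> h i\<bar> =
        \<bar>K / real M * (of_int (v h i) - real M / K * \<phi> h i)\<bar>"
      using K M by (simp add: abs_mult)
    also have "K / real M * (of_int (v h i) - real M / K * \<phi> h i) = K / real M * of_int (v h i) - \<phi> h i"
      using K M by (simp add: algebra_simps)
    finally show ?thesis by (simp add: abs_minus_commute)
  qed
  have D_bound: "(norm (D h i))\<^sup>2 \<le> (real M)\<^sup>2 * w (v h i)" if i: "i \<in> I" for h i
  proof (cases "v h i = 0")
    case True
    thus ?thesis using norm_dirichlet_le[where M = M and t = "t h i"] by (simp add: w_def D_def power_mono)
  next
    case False
    let ?u = "\<bar>of_int (v h i)\<bar> :: real"
    have u1: "?u \<ge> 1" using False by linarith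
    have "K / real M * ?u = \<bar>K / real M * of_int (v h i)\<bar>" using K by (simp add: abs_mult)
    also have "\<dots> \<le> \<bar>\<phi> h i\<bar> + K / real M / 2" using v_close[OF i, of h] by linarith
    finally have "K / real M * ?u - K / real M / 2 \<le> \<bar>\<phi> h i\<bar>" by linarith
    moreover have "K / real M * 1 \<le> K / real M * ?u" using u1 K M by (intro mult_left_mono) auto
    moreover have "c * u - c / 2 \<le> p \<Longrightarrow> c * 1 \<le> c * u \<Longrightarrow> c * u / 2 \<le> p" for c u p :: real by linarith
    ultimately have "K / real M * ?u / 2 \<le> \<bar>\<phi> h i\<bar>" by blast
    hence "norm (D h i) * (K / real M * ?u / 2) \<le> norm (D h i) * \<bar>\<phi> h i\<bar>"
      by (intro mult_left_mono) auto
    also have "\<dots> \<le> 1" unfolding D_def \<phi>_def by (rule norm_dirichlet_mult_le)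
    finally have "norm (D h i) \<le> real M * (2 / (K * ?u))"
      using K M u1 by (simp add: field_simps)
    hence "(norm (D h i))\<^sup>2 \<le> (real M * (2 / (K * ?u)))\<^sup>2" by (intro power_mono) auto
    also have "\<dots> = (real M)\<^sup>2 * w (v h i)" using False by (simp add: w_def power_mult_distrib power_divide)
    finally show ?thesis .
  qed
  have close_eq: False if h: "0 < h" "h < q" "\<And>i. i \<in> I \<Longrightarrow> \<exists>m::int. \<bar>t h i - of_int m\<bar> \<le> K / real M" for h
  proof -
    obtain i where i: "i \<in> I" "K / real M < \<bar>t h i - of_int (round (t h i))\<bar>"
      using far[OF h(1) h(2)] unfolding t_def K_def by blast
    thus False using h(3)[OF i(1)] round_diff_minimal[of "t h i"] by (metis linorder_not_le order_trans)
  qed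
  \<comment> \<open>Two frequencies in one cell would bring all coordinates of the frequency
    \<open>h' - h\<close> within \<open>K / M\<close> of integers, against
    \<open>far\<close>.\<close>
  have v_neq: "v h \<noteq> v h'" if "h < h'" "h' < q" for h h'
  proof
    assume eq: "v h = v h'"
    show False
    proof (rule close_eq[of "h' - h"])
      fix i assume i: "i \<in> I"
      have "\<bar>\<phi> h' i - \<phi> h i\<bar> \<le> K / real M"
        using v_close[OF i, of h] v_close[OF i, of h'] by (simp add: eq)
      moreover have "\<phi> h' i - \<phi> h i = t (h' - h) i - of_int (round (t h' i) - round (t h i))"
        using that by (simp add: \<phi>_def t_def of_nat_diff algebra_simps diff_divide_distrib)
      ultimately show "\<exists>m::int. \<bar>t (h' - h) i - of_int m\<bar> \<le> K / real M" by metis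
    qed (use that in auto)
  qed
  have inj: "inj_on v {..<q}"
    by (intro inj_onI) (metis lessThan_iff linorder_neqE_nat v_neq)
  \<comment> \<open>As the cells are distinct, the sum over \<open>h\<close> is at most the sum over
    the whole grid \<open>G\<close>, which factors into one-dimensional sums.\<close>
  define L where "L = nat (\<lceil>real M / K\<rceil>)"
  define G where "G = PiE I (\<lambda>_. {-int L..int L})"
  have vG: "v h \<in> G" for h
  proof -
    have "round (real M / K * \<phi> h i) \<in> {-int L..int L}" for i
    proof -
      have p: "\<bar>\<phi> h i\<bar> \<le> 1" using of_int_round_abs_le[of "t h i"] unfolding \<phi>_def by linarith
      have "\<bar>real M / K * \<phi> h i\<bar> \<le> real M / K * 1"
        unfolding abs_mult using K p by (intro mult_mono) auto
      also have "\<dots> \<le> real L" using K by (simp add: L_def)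
      finally show ?thesis by (rule round_mem_int_interval)
    qed
    thus ?thesis by (simp add: G_def v_def PiE_iff)
  qed
  have finG: "finite G" unfolding G_def using fin by (intro finite_PiE) auto
  have P0: "(\<Prod>i\<in>I. w (v 0 i)) = 1"
    by (simp add: v_def w_def \<phi>_def t_def)
  have "(\<Sum>h<q. \<Prod>i\<in>I. w (v h i)) = (\<Sum>g\<in>v ` {..<q}. \<Prod>i\<in>I. w (g i))"
    by (simp add: sum.reindex[OF inj])
  also have "\<dots> \<le> (\<Sum>g\<in>G. \<Prod>i\<in>I. w (g i))"
    using finG vG wnn by (intro sum_mono2) (auto intro!: prod_nonneg)
  also have "\<dots> = (\<Prod>i\<in>I. \<Sum>u\<in>{-int L..int L}. w u)"
    unfolding G_def by (rule prod_sum_PiE[OF fin, of "\<lambda>_. {-int L..int L}" "\<lambda>_. w", symmetric]) simp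
  also have "\<dots> = (\<Sum>u\<in>{-int L..int L}. w u) ^ card I" by simp
  also have "\<dots> \<le> (1 + 4 * (4 / K\<^sup>2)) ^ card I"
    unfolding w_def by (intro power_mono sum_int_inverse_squares_le sum_nonneg) auto
  also have "\<dots> < 2" using one_plus_power_lt_2[OF I] by (simp add: K_def)
  finally have less2: "(\<Sum>h<q. \<Prod>i\<in>I. w (v h i)) < 2" .
  have split: "{..<q} = insert 0 {1..<q}" using q by auto
  \<comment> \<open>The frequency 0 sits in the central cell and takes weight 1 of a total below 2,
    so less than 1 is left for all others.\<close>
  have less1: "(\<Sum>h=1..<q. \<Prod>i\<in>I. w (v h i)) < 1"
    using less2 P0 by (simp add: split)
  have normP: "norm (e h * (\<Prod>i\<in>I. D h i) * (\<Prod>i\<in>I. D h i)) \<le> ((real M)\<^sup>2) ^ card I * (\<Prod>i\<in>I. w (v h i))" for h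
  proof -
    have "norm (e h * (\<Prod>i\<in>I. D h i) * (\<Prod>i\<in>I. D h i)) = (\<Prod>i\<in>I. (norm (D h i))\<^sup>2)"
      by (simp add: norm_mult e_def prod_norm power2_eq_square prod.distrib)
    also have "\<dots> \<le> (\<Prod>i\<in>I. (real M)\<^sup>2 * w (v h i))"
      using D_bound by (intro prod_mono) auto
    finally show ?thesis by (simp add: prod.distrib)
  qed
  have "e 0 * (\<Prod>i\<in>I. D 0 i) * (\<Prod>i\<in>I. D 0 i) = of_real (((real M)\<^sup>2) ^ card I)"
    using unit_char_of_int[of 0] by (simp add: e_def D_def t_def power2_eq_square power_mult_distrib)
  hence "of_real (((real M)\<^sup>2) ^ card I) = - (\<Sum>h=1..<q. e h * (\<Prod>i\<in>I. D h i) * (\<Prod>i\<in>I. D h i))"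
    using zero unfolding split eq_neg_iff_add_eq_0 by (subst (asm) sum.insert) auto
  hence "norm (complex_of_real (((real M)\<^sup>2) ^ card I)) = norm (\<Sum>h=1..<q. e h * (\<Prod>i\<in>I. D h i) * (\<Prod>i\<in>I. D h i))"
    by simp
  hence "((real M)\<^sup>2) ^ card I = norm (\<Sum>h=1..<q. e h * (\<Prod>i\<in>I. D h i) * (\<Prod>i\<in>I. D h i))"
    by (simp only: norm_of_real) simp
  also have "\<dots> \<le> (\<Sum>h=1..<q. norm (e h * (\<Prod>i\<in>I. D h i) * (\<Prod>i\<in>I. D h i)))"
    by (rule norm_sum)
  also have "\<dots> \<le> (\<Sum>h=1..<q. ((real M)\<^sup>2) ^ card I * (\<Prod>i\<in>I. w (v h i)))"
    by (intro sum_mono normP)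
  also have "\<dots> = ((real M)\<^sup>2) ^ card I * (\<Sum>h=1..<q. \<Prod>i\<in>I. w (v h i))"
    by (simp add: sum_distrib_left)
  also have "\<dots> < ((real M)\<^sup>2) ^ card I * 1"
    using less1 M by (intro mult_strict_left_mono) auto
  finally show False by simp
qed

section \<open>Upper bounds for Frobenius numbers\<close>

lemma bezout_Gcd:
  fixes a :: "'i \<Rightarrow> nat"
  assumes "finite S"
  shows "\<exists>c :: 'i \<Rightarrow> int. (\<Sum>i\<in>S. c i * int (a i)) = int (Gcd (a ` S))"
  using assms
proof (induction rule: finite_induct)
  case (insert x S)
  then obtain c where c: "(\<Sum>i\<in>S. c i * int (a i)) = int (Gcd (a ` S))" by blast
  obtain u v where uv: "u * int (a x) + v * int (Gcd (a ` S)) = gcd (int (a x)) (int (Gcd (a ` S)))"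
    using bezout_int by blast
  have "(\<Sum>i\<in>insert x S. (if i = x then u else v * c i) * int (a i)) =
      u * int (a x) + (\<Sum>i\<in>S. v * (c i * int (a i)))"
    using insert.hyps by (auto intro!: sum.cong)
  also have "\<dots> = u * int (a x) + v * int (Gcd (a ` S))"
    by (simp add: sum_distrib_left[symmetric] c)
  also have "\<dots> = int (Gcd (a ` insert x S))" using uv by simp
  finally show ?case by (intro exI[of _ "\<lambda>i. if i = x then u else v * c i"])
qed simp

lemma primitive_combination:
  assumes "a \<in> primitive_vectors"
  shows "\<exists>c :: 'n::finite \<Rightarrow> int. (\<Sum>i\<in>UNIV. c i * int (a $ i)) = 1"
  using bezout_Gcd[of UNIV "\<lambda>i. a $ i"] assms by (simp add: primitive_vectors_def)

text \<open>\<open>GREATEST\<close> over \<open>int\<close> needs both a witness and an upper bound;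
  the maximum is then taken over the finite set between them.\<close>

lemma exists_Greatest_int:
  fixes P :: "int \<Rightarrow> bool"
  assumes "P m" and bound: "\<And>x. P x \<Longrightarrow> x \<le> b"
  shows "P (GREATEST x. P x)"
proof -
  let ?S = "{x. P x \<and> m \<le> x}"
  have fin: "finite ?S" by (rule finite_subset[of _ "{m..b}"]) (auto dest: bound)
  have "m \<in> ?S" using assms by simp
  hence M: "Max ?S \<in> ?S" "\<And>x. x \<in> ?S \<Longrightarrow> x \<le> Max ?S"
    using Max_in[OF fin] Max_ge[OF fin] by blast+
  have "(GREATEST x. P x) = Max ?S"
  proof (rule Greatest_equality)
    fix y assume "P y"
    thus "y \<le> Max ?S" using M(2)[of y] M(1) by (cases "m \<le> y") auto
  qed (use M in auto)
  thus ?thesis using M by simp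
qed

text \<open>A nonrepresentable \<open>m\<close> lies below the sum \<open>S\<close> congruent to it
  by a positive multiple of \<open>a $ k\<close>, as otherwise copies of \<open>a $ k\<close> added
  to \<open>S\<close> would reach \<open>m\<close>. So \<open>m \<le> W - a $ k\<close>, and this
  \<open>a $ k\<close> cancels the one in \<open>frobenius_f\<close>.\<close>

lemma frobenius_f_le:
  fixes a :: "nat ^ 'n::finite"
  assumes pos: "a $ k > 0"
    and cover: "\<And>r. \<exists>z :: 'n \<Rightarrow> nat. int (a $ k) dvd (\<Sum>i\<in>UNIV - {k}. int (z i) * int (a $ i)) - r \<and>
      (\<Sum>i\<in>UNIV - {k}. int (z i) * int (a $ i)) \<le> W"
  shows "frobenius_f a \<le> W + (\<Sum>i\<in>UNIV - {k}. int (a $ i))"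
proof -
  have bound: "m \<le> W - int (a $ k)" if nr: "\<not> representable a m" for m
  proof -
    obtain z :: "'n \<Rightarrow> nat" where z: "int (a $ k) dvd (\<Sum>i\<in>UNIV - {k}. int (z i) * int (a $ i)) - m"
      "(\<Sum>i\<in>UNIV - {k}. int (z i) * int (a $ i)) \<le> W" using cover[of m] by blast
    define S where "S = (\<Sum>i\<in>UNIV - {k}. int (z i) * int (a $ i))"
    obtain t where t: "S - m = int (a $ k) * t" using z(1) unfolding S_def by (elim dvdE)
    have "t > 0"
    proof (rule ccontr)
      assume "\<not> t > 0"
      then obtain u :: nat where u: "t = - int u"
        by (metis minus_minus neg_0_le_iff_le nonneg_int_cases not_le)
      define y :: "nat ^ 'n" where "y = (\<chi> i. if i = k then u else z i)"
      have "(\<Sum>i\<in>UNIV. int (y $ i) * int (a $ i)) = int u * int (a $ k) + S"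
        unfolding S_def by (subst sum.remove[of UNIV k]) (auto simp: y_def intro!: sum.cong)
      also have "\<dots> = m" using t u by (simp add: algebra_simps)
      finally show False using nr unfolding representable_def by metis
    qed
    hence "int (a $ k) * 1 \<le> int (a $ k) * t" by (intro mult_left_mono) auto
    thus ?thesis using t z(2) unfolding S_def by linarith
  qed
  \<comment> \<open>The witness for the existence of the maximum; it is available even if every
    natural number is representable.\<close>
  have "\<not> representable a (-1)"
  proof
    assume "representable a (-1)"
    then obtain y :: "nat ^ 'n" where "-1 = (\<Sum>i\<in>UNIV. int (y $ i) * int (a $ i))"
      unfolding representable_def by blast
    moreover have "(\<Sum>i\<in>UNIV. int (y $ i) * int (a $ i)) \<ge> 0" by (intro sum_nonneg) auto
    ultimately show False by simp
  qed
  hence "\<not> representable a (frobenius_number a)"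
    unfolding frobenius_number_def using bound by (rule exists_Greatest_int)
  hence "frobenius_number a \<le> W - int (a $ k)" by (rule bound)
  moreover have "(\<Sum>i\<in>UNIV. int (a $ i)) = int (a $ k) + (\<Sum>i\<in>UNIV - {k}. int (a $ i))"
    by (rule sum.remove) auto
  ultimately show ?thesis by (simp add: frobenius_f_def)
qed

text \<open>Writes a combination as a word in the generators, so that the prefix argument can
  shorten it.\<close>

lemma sum_as_sum_list:
  fixes f :: "'i \<Rightarrow> int"
  assumes "finite S"
  shows "\<exists>xs. set xs \<subseteq> S \<and> sum_list (map f xs) = (\<Sum>i\<in>S. int (z i) * f i)"
  using assms
proof (induction rule: finite_induct)
  case (insert x S)
  then obtain xs where "set xs \<subseteq> S" "sum_list (map f xs) = (\<Sum>i\<in>S. int (z i) * f i)" by blast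
  thus ?case using insert.hyps
    by (intro exI[of _ "replicate (z x) x @ xs"]) (auto simp: sum_list_replicate)
qed auto

text \<open>In a shortest list of generators with prescribed sum modulo \<open>q\<close>, no two prefix sums agree
  modulo \<open>q\<close>, as the block between them could be removed.\<close>

lemma short_residue_list:
  fixes f :: "'i \<Rightarrow> int"
  assumes "q > 0" and xs: "set xs \<subseteq> S" "int q dvd sum_list (map f xs) - r"
  shows "\<exists>ys. set ys \<subseteq> S \<and> int q dvd sum_list (map f ys) - r \<and> length ys < q"
  using xs
proof (induction "length xs" arbitrary: xs rule: less_induct)
  case less
  show ?case
  proof (cases "length xs < q")
    case False
    define p where "p j = sum_list (map f (take j xs)) mod int q" for j
    \<comment> \<open>Counting the empty one there are \<open>length xs + 1 > q\<close>
      prefixes.\<close>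
    have "\<not> inj_on p {..length xs}"
    proof
      assume "inj_on p {..length xs}"
      moreover have "p ` {..length xs} \<subseteq> {0..<int q}" using assms(1) by (auto simp: p_def)
      ultimately have "card {..length xs} \<le> card {0..<int q}" by (metis card_inj_on_le finite_atLeastLessThan_int)
      thus False using False by simp
    qed
    then obtain i' j' where "i' \<le> length xs" "j' \<le> length xs" "i' \<noteq> j'" "p i' = p j'"
      by (auto simp: inj_on_def)
    then obtain i j where ij: "i < j" "j \<le> length xs" "p i = p j"
      by (cases "i' < j'") (metis, metis linorder_neqE_nat)
    define ys where "ys = take i xs @ drop j xs"
    have dec: "sum_list (map f xs) = sum_list (map f (take j xs)) + sum_list (map f (drop j xs))"
      by (metis append_take_drop_id map_append sum_list_append)
    have "int q dvd sum_list (map f (take j xs)) - sum_list (map f (take i xs))"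
      using ij(3)[symmetric] by (simp add: p_def mod_eq_dvd_iff)
    hence "int q dvd sum_list (map f xs) - r - (sum_list (map f (take j xs)) - sum_list (map f (take i xs)))"
      using less.prems(2) by (rule dvd_diff[rotated])
    also have "sum_list (map f xs) - r - (sum_list (map f (take j xs)) - sum_list (map f (take i xs))) =
       sum_list (map f ys) - r" by (simp add: dec ys_def)
    finally have "int q dvd sum_list (map f ys) - r" .
    moreover have "set ys \<subseteq> S" using less.prems(1) unfolding ys_def
      by (auto dest: in_set_takeD in_set_dropD)
    moreover have "length ys < length xs" using ij by (simp add: ys_def)
    ultimately show ?thesis using less.hyps by blast
  qed (use less.prems in blast)
qed

text \<open>A Bezout combination scaled by \<open>r\<close> gives the residue \<open>r\<close>;
  modulo \<open>q\<close> its \<open>k\<close>-th term vanishes and the other coefficients can be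
  made nonnegative. Shortening leaves at most \<open>q - 1\<close> summands, each at most
  \<open>A\<close>.\<close>

lemma frobenius_f_le_Schur:
  fixes a :: "nat ^ 'n::finite"
  assumes prim: "a \<in> primitive_vectors" and A: "\<And>i. i \<noteq> k \<Longrightarrow> a $ i \<le> A"
  shows "frobenius_f a \<le> (int (a $ k) - 1) * int A + (\<Sum>i\<in>UNIV - {k}. int (a $ i))"
proof (rule frobenius_f_le)
  define q where "q = a $ k"
  show pos: "a $ k > 0" using prim by (simp add: primitive_vectors_def)
  fix r :: int
  let ?f = "\<lambda>i. int (a $ i)"
  obtain c :: "'n \<Rightarrow> int" where c: "(\<Sum>i\<in>UNIV. c i * ?f i) = 1"
    using primitive_combination[OF prim] by blast
  define z where "z i = nat ((r * c i) mod int q)" for i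
  obtain xs where xs: "set xs \<subseteq> UNIV - {k}" "sum_list (map ?f xs) = (\<Sum>i\<in>UNIV - {k}. int (z i) * ?f i)"
    using sum_as_sum_list[of "UNIV - {k}" ?f z] by auto
  have "int q dvd (\<Sum>i\<in>UNIV. r * c i * ?f i) - (\<Sum>i\<in>UNIV - {k}. int (z i) * ?f i)"
  proof -
    have "(\<Sum>i\<in>UNIV. r * c i * ?f i) - (\<Sum>i\<in>UNIV - {k}. int (z i) * ?f i) =
        r * c k * ?f k + (\<Sum>i\<in>UNIV - {k}. (r * c i - int (z i)) * ?f i)"
      by (subst sum.remove[of UNIV k]) (auto simp: sum_subtractf left_diff_distrib)
    also have "int q dvd \<dots>"
      using pos by (intro dvd_add dvd_sum) (auto simp: q_def z_def minus_mod_eq_mult_div)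
    finally show ?thesis .
  qed
  hence "int q dvd r - sum_list (map ?f xs)"
    using c by (simp add: xs(2) mult.assoc sum_distrib_left[symmetric])
  hence "int q dvd sum_list (map ?f xs) - r" by (metis dvd_minus_iff minus_diff_eq)
  then obtain ys where ys: "set ys \<subseteq> UNIV - {k}" "int q dvd sum_list (map ?f ys) - r" "length ys < q"
    using short_residue_list[of q xs "UNIV - {k}" ?f r] xs(1) pos by (auto simp: q_def)
  have eq: "(\<Sum>i\<in>UNIV - {k}. int (count_list ys i) * ?f i) = sum_list (map ?f ys)"
  proof -
    have "sum_list (map ?f ys) = int (sum_list (map (($) a) ys))"
      by (induction ys) auto
    also have "\<dots> = (\<Sum>i\<in>set ys. int (count_list ys i) * ?f i)"
      by (simp add: sum_list_map_eq_sum_count)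
    also have "\<dots> = (\<Sum>i\<in>UNIV - {k}. int (count_list ys i) * ?f i)"
      using ys(1) by (intro sum.mono_neutral_left) (auto simp: count_list_0_iff)
    finally show ?thesis by simp
  qed
  have "sum_list (map ?f ys) \<le> int (length ys) * int A"
    using ys(1) A by (induction ys) (auto simp: algebra_simps intro!: add_mono)
  also have "\<dots> \<le> (int q - 1) * int A" using ys(3) by (intro mult_right_mono) auto
  finally show "\<exists>z :: 'n \<Rightarrow> nat. int (a $ k) dvd (\<Sum>i\<in>UNIV - {k}. int (z i) * ?f i) - r \<and>
      (\<Sum>i\<in>UNIV - {k}. int (z i) * ?f i) \<le> (int (a $ k) - 1) * int A"
    using ys(2) eq unfolding q_def by (intro exI[of _ "count_list ys"]) simp
qed

section \<open>Size of the normalising factor \<open>s\<close>\<close>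

lemma norm_real_vec_sq: "(norm (real_vec a))\<^sup>2 = (\<Sum>i\<in>UNIV. (real (a $ i))\<^sup>2)"
  unfolding power2_norm_eq_inner by (simp add: inner_vec_def real_vec_def power2_eq_square)

lemma norm_real_vec_pair:
  assumes "i \<noteq> j"
  shows "(real (a $ i))\<^sup>2 + (real (a $ j))\<^sup>2 \<le> (norm (real_vec a))\<^sup>2"
proof -
  have "(\<Sum>l\<in>{i, j}. (real (a $ l))\<^sup>2) \<le> (\<Sum>l\<in>UNIV. (real (a $ l))\<^sup>2)"
    by (intro sum_mono2) auto
  thus ?thesis using assms by (simp add: norm_real_vec_sq)
qed

text \<open>Makes each summand of the numerator of \<open>s\<close> dominate a product of two
  distinct entries.\<close>

lemma le_sqrt_norm_diff:
  assumes "i \<noteq> j"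
  shows "real (a $ i) \<le> sqrt ((norm (real_vec a))\<^sup>2 - (real (a $ j))\<^sup>2)"
  using norm_real_vec_pair[OF assms, of a] by (intro real_le_rsqrt) linarith

lemma norm_real_vec_ge_one:
  assumes "a \<in> primitive_vectors"
  shows "norm (real_vec a) \<ge> 1"
proof -
  fix i
  have "1 \<le> real (a $ i)" using assms by (simp add: primitive_vectors_def Suc_leI)
  also have "\<dots> = \<bar>real_vec a $ i\<bar>" by (simp add: real_vec_def)
  also have "\<dots> \<le> norm (real_vec a)" by (rule component_le_norm_cart)
  finally show ?thesis .
qed

lemma primitive_top_two:
  fixes a :: "nat ^ 'n::finite"
  assumes "CARD('n) \<ge> 2"
  obtains k l where "k \<noteq> l" "\<And>i. a $ i \<le> a $ k" "\<And>i. i \<noteq> k \<Longrightarrow> a $ i \<le> a $ l"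
proof -
  obtain k where k: "\<And>i. a $ i \<le> a $ k"
  proof -
    have "Max (range (($) a)) \<in> range (($) a)" by (intro Max_in) auto
    then obtain k where "Max (range (($) a)) = a $ k" by blast
    moreover have "a $ i \<le> Max (range (($) a))" for i by (intro Max_ge) auto
    ultimately show ?thesis by (intro that[of k]) simp
  qed
  have ne: "UNIV - {k} \<noteq> {}"
  proof
    assume "UNIV - {k} = {}"
    hence "UNIV = {k}" by auto
    hence "CARD('n) = card {k}" by simp
    thus False using assms by simp
  qed
  have "Max (($) a ` (UNIV - {k})) \<in> ($) a ` (UNIV - {k})" using ne by (intro Max_in) auto
  then obtain l where l: "l \<in> UNIV - {k}" "Max (($) a ` (UNIV - {k})) = a $ l" by (elim imageE)
  have "a $ i \<le> a $ l" if "i \<noteq> k" for i unfolding l(2)[symmetric] using that by (intro Max_ge) auto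
  thus ?thesis using that k l(1) by (metis DiffD2 insertCI)
qed

lemma frobenius_s_times:
  assumes "a \<in> primitive_vectors"
  shows "frobenius_s a * norm (real_vec a) powr (1 - 1 / (real CARD('n) - 1)) =
    (\<Sum>j\<in>UNIV. real (a $ j) * sqrt ((norm (real_vec (a :: nat ^ 'n::finite)))\<^sup>2 - (real (a $ j))\<^sup>2))"
proof -
  have "norm (real_vec a) \<noteq> 0" using norm_real_vec_ge_one[OF assms] by linarith
  thus ?thesis by (simp add: frobenius_s_def)
qed

text \<open>Schur's bound is matched with the numerator of \<open>s\<close> summand by summand:
  \<open>(a $ k - 1) * a $ l\<close> with the index \<open>k\<close>, and each remaining
  \<open>a $ i \<le> a $ i * a $ k\<close> with the index \<open>i\<close>.\<close>

lemma frobenius_f_le_s: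
  fixes a :: "nat ^ 'n::finite"
  assumes prim: "a \<in> primitive_vectors" and d: "CARD('n) \<ge> 2"
  shows "real_of_int (frobenius_f a) \<le> frobenius_s a * norm (real_vec a) powr (1 - 1 / (real CARD('n) - 1))"
proof -
  obtain k l where kl: "k \<noteq> l" "\<And>i. a $ i \<le> a $ k" "\<And>i. i \<noteq> k \<Longrightarrow> a $ i \<le> a $ l"
    using primitive_top_two[OF d] by metis
  have pos: "a $ i \<ge> 1" for i using prim by (simp add: primitive_vectors_def Suc_leI)
  have "frobenius_f a \<le> (int (a $ k) - 1) * int (a $ l) + (\<Sum>i\<in>UNIV - {k}. int (a $ i))"
    by (rule frobenius_f_le_Schur[OF prim kl(3)])
  hence "real_of_int (frobenius_f a) \<le> real_of_int ((int (a $ k) - 1) * int (a $ l) + (\<Sum>i\<in>UNIV - {k}. int (a $ i)))"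
    by (simp only: of_int_le_iff)
  also have "\<dots> = (real (a $ k) - 1) * real (a $ l) + (\<Sum>i\<in>UNIV - {k}. real (a $ i))" by simp
  also have "\<dots> \<le> real (a $ k) * real (a $ l) + (\<Sum>i\<in>UNIV - {k}. real (a $ i) * real (a $ k))"
    using pos[of k] by (intro add_mono mult_right_mono sum_mono) (auto simp: mult_le_cancel_left1)
  also have "\<dots> \<le> real (a $ k) * sqrt ((norm (real_vec a))\<^sup>2 - (real (a $ k))\<^sup>2) +
      (\<Sum>i\<in>UNIV - {k}. real (a $ i) * sqrt ((norm (real_vec a))\<^sup>2 - (real (a $ i))\<^sup>2))"
    using kl(1) by (intro add_mono mult_left_mono sum_mono le_sqrt_norm_diff) auto
  also have "\<dots> = (\<Sum>i\<in>UNIV. real (a $ i) * sqrt ((norm (real_vec a))\<^sup>2 - (real (a $ i))\<^sup>2))"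
    by (rule sum.remove[symmetric]) auto
  finally show ?thesis by (simp only: frobenius_s_times[OF prim])
qed

lemma frobenius_s_ge:
  fixes a :: "nat ^ 'n::finite"
  assumes prim: "a \<in> primitive_vectors" and kl: "k \<noteq> l"
  shows "real (a $ l) * real (a $ k) \<le> frobenius_s a * norm (real_vec a) powr (1 - 1 / (real CARD('n) - 1))"
proof -
  have "real (a $ l) * real (a $ k) \<le> real (a $ l) * sqrt ((norm (real_vec a))\<^sup>2 - (real (a $ l))\<^sup>2)"
    using kl by (intro mult_left_mono le_sqrt_norm_diff) auto
  also have "\<dots> \<le> (\<Sum>i\<in>UNIV. real (a $ i) * sqrt ((norm (real_vec a))\<^sup>2 - (real (a $ i))\<^sup>2))"
  proof (rule member_le_sum)
    fix i assume "i \<in> UNIV - {l}"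
    have "(real (a $ i))\<^sup>2 \<le> (norm (real_vec a))\<^sup>2"
      unfolding norm_real_vec_sq by (rule member_le_sum) auto
    thus "0 \<le> real (a $ i) * sqrt ((norm (real_vec a))\<^sup>2 - (real (a $ i))\<^sup>2)" by simp
  qed auto
  finally show ?thesis by (simp only: frobenius_s_times[OF prim])
qed

lemma frobenius_s_pos:
  fixes a :: "nat ^ 'n::finite"
  assumes prim: "a \<in> primitive_vectors" and d: "CARD('n) \<ge> 2"
  shows "frobenius_s a > 0"
proof -
  obtain k l :: 'n where kl: "k \<noteq> l" using primitive_top_two[OF d] by metis
  have "0 < real (a $ l) * real (a $ k)" using prim by (simp add: primitive_vectors_def)
  hence "0 < frobenius_s a * norm (real_vec a) powr (1 - 1 / (real CARD('n) - 1))"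
    using frobenius_s_ge[OF prim kl] by linarith
  thus ?thesis using powr_ge_zero by (metis zero_less_mult_pos2 less_le_not_le linorder_not_le mult_nonpos_nonneg)
qed

section \<open>Large Frobenius numbers and integer vectors close to a line\<close>

definition int_vec :: "int ^ 'n \<Rightarrow> real ^ 'n" where
  "int_vec v = (\<chi> i. of_int (v $ i))"

text \<open>The squared area of the parallelogram spanned by \<open>u\<close> and \<open>v\<close>;
  for integer vectors it is an integer.\<close>

definition gram_det :: "'a::real_inner \<Rightarrow> 'a \<Rightarrow> real" where
  "gram_det u v = (u \<bullet> u) * (v \<bullet> v) - (u \<bullet> v)\<^sup>2"

lemma gram_det_shear: "gram_det u (v + c *\<^sub>R u) = gram_det u v"
  by (simp add: gram_det_def inner_add_left inner_add_right inner_commute algebra_simps power2_eq_square)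

lemma gram_det_commute: "gram_det u v = gram_det v u"
  by (simp add: gram_det_def inner_commute mult.commute)

lemma gram_det_nonneg: "gram_det u v \<ge> 0"
  using Cauchy_Schwarz_ineq[of u v] by (simp add: gram_det_def)

lemma gram_det_le: "gram_det u v \<le> (norm u * norm v)\<^sup>2"
  by (simp add: gram_det_def power_mult_distrib power2_norm_eq_inner)

text \<open>The equality case of Cauchy-Schwarz: \<open>?w\<close> is \<open>u \<bullet> u\<close>
  times the component of \<open>v\<close> orthogonal to \<open>u\<close>.\<close>

lemma gram_det_eq_0:
  assumes "gram_det u v = 0"
  shows "(u \<bullet> u) *\<^sub>R v = (u \<bullet> v) *\<^sub>R u"
proof -
  let ?w = "(u \<bullet> u) *\<^sub>R v - (u \<bullet> v) *\<^sub>R u"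
  have "?w \<bullet> ?w = (u \<bullet> u) * gram_det u v"
    by (simp add: gram_det_def inner_diff_left inner_diff_right inner_commute algebra_simps power2_eq_square)
  thus ?thesis using assms by simp
qed

lemma real_nat_floor_ge_half:
  assumes "y \<ge> (1::real)"
  shows "y / 2 \<le> real (nat \<lfloor>y\<rfloor>)"
proof -
  have "\<lfloor>y\<rfloor> \<ge> 1" using assms by simp
  hence "real (nat \<lfloor>y\<rfloor>) = of_int \<lfloor>y\<rfloor>" by simp
  moreover have "y < of_int \<lfloor>y\<rfloor> + 1" by linarith
  moreover have "(1::real) \<le> of_int \<lfloor>y\<rfloor>" using \<open>\<lfloor>y\<rfloor> \<ge> 1\<close> by simp
  ultimately show ?thesis by linarith
qed

lemma norm_le_sqrt_card_max:
  fixes a :: "nat ^ 'n::finite"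
  assumes "\<And>i. a $ i \<le> a $ k"
  shows "norm (real_vec a) \<le> sqrt (real CARD('n)) * real (a $ k)"
proof -
  have "(norm (real_vec a))\<^sup>2 \<le> (\<Sum>i\<in>(UNIV :: 'n set). (real (a $ k))\<^sup>2)"
    unfolding norm_real_vec_sq using assms by (intro sum_mono power_mono) auto
  also have "\<dots> = (sqrt (real CARD('n)) * real (a $ k))\<^sup>2" by (simp add: power_mult_distrib)
  finally show ?thesis by (rule power2_le_imp_le) simp
qed

text \<open>A large \<open>f\<close> prevents the box of size \<open>M\<close> from covering all
  residues modulo the largest entry \<open>q\<close>, so some multiple \<open>h / q\<close> of
  \<open>a\<close> with \<open>0 < h < q\<close> is close to an integer vector \<open>m\<close>.
  Shearing \<open>m\<close> along \<open>a\<close> to the error vector \<open>\<delta>\<close> keeps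
  the area, which is therefore at most \<open>norm a * norm \<delta>\<close>.\<close>

lemma large_frobenius_near_integer_line:
  fixes a :: "nat ^ 'n::finite"
  defines "n \<equiv> real CARD('n) - 1"
  assumes prim: "a \<in> primitive_vectors" and d: "CARD('n) \<ge> 2"
    and R: "R \<ge> 2 * n * sqrt (real CARD('n))"
    and large: "real_of_int (frobenius_f a) / frobenius_s a > R"
  shows "\<exists>m. 0 < gram_det (real_vec a) (int_vec m) \<and> norm (int_vec m) \<le> norm (real_vec a) \<and>
    gram_det (real_vec a) (int_vec m) \<le> (32 * n ^ 3 * sqrt (real CARD('n)) * norm (real_vec a) powr (1 - 1 / n) / R)\<^sup>2"
proof -
  obtain k l where kl: "k \<noteq> l" "\<And>i. a $ i \<le> a $ k" "\<And>i. i \<noteq> k \<Longrightarrow> a $ i \<le> a $ l"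
    using primitive_top_two[OF d] by metis
  define q where "q = a $ k"
  define A where "A = a $ l"
  define I where "I = UNIV - {k}"
  define N where "N = norm (real_vec a)"
  \<comment> \<open>The value for which \<open>2 * n * y * A \<le> R * s a\<close> follows from
    \<open>s a \<ge> A * q / N powr (1 - 1 / n)\<close> and \<open>q \<ge> N / sqrt d\<close>; the
    lower bound on \<open>R\<close> and \<open>N \<ge> 1\<close> give
    \<open>y \<ge> 1\<close>.\<close>
  define y where "y = R * N powr (1 / n) / (2 * n * sqrt (real CARD('n)))"
  define M where "M = nat \<lfloor>y\<rfloor>"
  have pos: "a $ i > 0" for i using prim by (simp add: primitive_vectors_def)
  have q0: "q > 0" and A0: "A > 0" using pos by (auto simp: q_def A_def)
  have n1: "n \<ge> 1" using d by (simp add: n_def)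
  have cardI: "real (card I) = n" using d by (simp add: I_def n_def card_Diff_singleton of_nat_diff)
  have cardI0: "card I > 0" using cardI n1 by simp
  have N1: "N \<ge> 1" using norm_real_vec_ge_one[OF prim] by (simp add: N_def)
  have sd: "sqrt (real CARD('n)) > 0" by simp
  have nsd: "2 * n * sqrt (real CARD('n)) > 0" using n1 sd by simp
  have Rpos: "R > 0" using R nsd by linarith
  have y1: "y \<ge> 1"
  proof -
    have "2 * n * sqrt (real CARD('n)) * 1 \<le> R * N powr (1 / n)"
      using R N1 n1 nsd Rpos by (intro mult_mono ge_one_powr_ge_zero) auto
    thus ?thesis using nsd by (simp add: y_def divide_simps)
  qed
  have My: "y / 2 \<le> real M" "real M \<le> y" using real_nat_floor_ge_half[OF y1] y1 by (auto simp: M_def)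
  have M0: "M > 0" using My y1 by linarith
  have Npow: "N = N powr (1 - 1 / n) * N powr (1 / n)" using N1 by (simp add: powr_add[symmetric])
  have f_gt: "real_of_int (frobenius_f a) > 2 * n * real M * real A"
  proof -
    have "2 * n * real M \<le> 2 * n * y" using My n1 by simp
    also have "\<dots> = R * N powr (1 / n) / sqrt (real CARD('n))" using n1 by (simp add: y_def)
    finally have "2 * n * real M * real A \<le> R * N powr (1 / n) / sqrt (real CARD('n)) * real A"
      by (rule mult_right_mono) simp
    also have "\<dots> = R * (real A * (N / sqrt (real CARD('n))) / N powr (1 - 1 / n))"
      using Npow N1 by (simp add: field_simps)
    also have "\<dots> \<le> R * frobenius_s a"
    proof (intro mult_left_mono)
      have "real A * (N / sqrt (real CARD('n))) \<le> real A * real q"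
        using norm_le_sqrt_card_max[OF kl(2)] sd
        by (intro mult_left_mono) (auto simp: N_def q_def divide_simps mult.commute)
      also have "\<dots> \<le> frobenius_s a * N powr (1 - 1 / n)"
        using frobenius_s_ge[OF prim kl(1)] by (simp add: N_def n_def A_def q_def)
      finally show "real A * (N / sqrt (real CARD('n))) / N powr (1 - 1 / n) \<le> frobenius_s a"
        using N1 by (subst pos_divide_le_eq) auto
    qed (use Rpos in simp)
    also have "\<dots> < real_of_int (frobenius_f a)"
      using large frobenius_s_pos[OF prim d] by (simp add: pos_less_divide_eq)
    finally show ?thesis .
  qed
  define t where "t h i = real h * (of_int (int (a $ i)) / real q)" for h :: nat and i
  have "\<exists>h. 0 < h \<and> h < q \<and> (\<forall>i\<in>I. \<bar>t h i - of_int (round (t h i))\<bar> \<le> 8 * n / real M)"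
  proof (rule ccontr)
    assume no: "\<not> ?thesis"
    have far: "\<exists>i\<in>I. 8 * real (card I) / real M <
        \<bar>real h * (of_int (int (a $ i)) / real q) - of_int (round (real h * (of_int (int (a $ i)) / real q)))\<bar>"
      if "0 < h" "h < q" for h
      using no that unfolding t_def cardI by (meson not_le)
    have "frobenius_f a \<le> int (card I) * int (2 * M - 2) * int A + (\<Sum>i\<in>UNIV - {k}. int (a $ i))"
    proof (rule frobenius_f_le)
      fix r :: int
      obtain z :: "'n \<Rightarrow> nat" where z: "\<And>i. i \<in> I \<Longrightarrow> z i \<le> 2 * M - 2"
        "int q dvd (\<Sum>i\<in>I. int (z i) * int (a $ i)) - r"
        using residues_covered_by_box[OF finite cardI0 q0 M0 far, of r] by blast
      have "(\<Sum>i\<in>I. int (z i) * int (a $ i)) \<le> (\<Sum>i\<in>I. int (2 * M - 2) * int A)"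
      proof (rule sum_mono)
        fix i assume i: "i \<in> I"
        hence "a $ i \<le> A" using kl(3) by (simp add: I_def A_def)
        with z(1)[OF i] show "int (z i) * int (a $ i) \<le> int (2 * M - 2) * int A"
          by (intro mult_mono) auto
      qed
      thus "\<exists>z :: 'n \<Rightarrow> nat. int (a $ k) dvd (\<Sum>i\<in>UNIV - {k}. int (z i) * int (a $ i)) - r \<and>
          (\<Sum>i\<in>UNIV - {k}. int (z i) * int (a $ i)) \<le> int (card I) * int (2 * M - 2) * int A"
        using z(2) by (intro exI[of _ z]) (simp add: I_def q_def)
    qed (use pos in simp)
    also have "(\<Sum>i\<in>UNIV - {k}. int (a $ i)) \<le> (\<Sum>i\<in>UNIV - {k}. int A)"
      using kl(3) by (intro sum_mono) (auto simp: A_def)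
    also have "(\<Sum>i\<in>UNIV - {k}. int A) = int (card I) * int A" by (simp add: I_def)
    \<comment> \<open>The sum of the other entries inside \<open>f\<close> costs one more unit of
      coefficient, which fits because the box coefficients stop at \<open>2 * M - 2\<close>.\<close>
    also have "int (card I) * int (2 * M - 2) * int A + int (card I) * int A \<le> int (card I) * int (2 * M) * int A"
    proof -
      have "int (2 * M - 2) + 1 \<le> int (2 * M)" using M0 by simp
      hence "(int (2 * M - 2) + 1) * (int (card I) * int A) \<le> int (2 * M) * (int (card I) * int A)"
        by (rule mult_right_mono) simp
      thus ?thesis by (simp add: algebra_simps)
    qed
    finally have "frobenius_f a \<le> int (card I) * int (2 * M) * int A" by simp
    hence "real_of_int (frobenius_f a) \<le> real_of_int (int (card I) * int (2 * M) * int A)"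
      by (simp only: of_int_le_iff)
    also have "\<dots> = 2 * n * real M * real A" by (simp add: cardI)
    finally show False using f_gt by simp
  qed
  then obtain h where h: "0 < h" "h < q" "\<And>i. i \<in> I \<Longrightarrow> \<bar>t h i - of_int (round (t h i))\<bar> \<le> 8 * n / real M"
    by blast
  define m :: "int ^ 'n" where "m = (\<chi> i. round (t h i))"
  \<comment> \<open>The coordinate \<open>k\<close> of \<open>(h / q) a\<close> is the integer
    \<open>h\<close>, so \<open>\<delta>\<close> vanishes there; this later excludes that
    \<open>m\<close> is parallel to \<open>a\<close>.\<close>
  define \<delta> where "\<delta> = int_vec m + (- (real h / real q)) *\<^sub>R real_vec a"
  have \<delta>i: "\<delta> $ i = of_int (round (t h i)) - t h i" for i
    by (simp add: \<delta>_def int_vec_def m_def real_vec_def t_def)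
  have \<delta>k: "\<delta> $ k = 0" unfolding \<delta>i using q0 by (simp add: t_def q_def)
  have gr: "gram_det (real_vec a) (int_vec m) = gram_det (real_vec a) \<delta>"
    unfolding \<delta>_def by (rule gram_det_shear[symmetric])
  have "norm \<delta> \<le> (\<Sum>i\<in>UNIV. \<bar>\<delta> $ i\<bar>)" by (rule norm_le_l1_cart)
  also have "\<dots> = (\<Sum>i\<in>I. \<bar>\<delta> $ i\<bar>)"
    using \<delta>k by (intro sum.mono_neutral_right) (auto simp: I_def)
  also have "\<dots> \<le> (\<Sum>i\<in>I. 8 * n / real M)"
    using h(3) by (intro sum_mono) (simp add: \<delta>i abs_minus_commute)
  also have "\<dots> = n * (8 * n / real M)" by (simp add: cardI)
  also have "\<dots> \<le> n * (8 * n / (y / 2))"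
    using My(1) y1 n1 by (intro mult_left_mono divide_left_mono) auto
  finally have \<delta>_norm: "norm \<delta> \<le> 16 * n\<^sup>2 / y" by (simp add: power2_eq_square mult_ac)
  \<comment> \<open>Inserting \<open>y\<close> turns \<open>N / N powr (1 / n)\<close> into the
    exponent \<open>1 - 1 / n\<close> and collects the constant \<open>32 = 16 * 2\<close>.\<close>
  have "N * norm \<delta> \<le> N * (16 * n\<^sup>2 / y)" using \<delta>_norm N1 by (intro mult_left_mono) auto
  also have "\<dots> = 32 * n ^ 3 * sqrt (real CARD('n)) * N powr (1 - 1 / n) / R"
    unfolding y_def using Npow N1 Rpos n1 by (simp add: field_simps power2_eq_square power3_eq_cube)
  finally have "(N * norm \<delta>)\<^sup>2 \<le> (32 * n ^ 3 * sqrt (real CARD('n)) * N powr (1 - 1 / n) / R)\<^sup>2"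
    using N1 by (intro power_mono) auto
  hence upper: "gram_det (real_vec a) (int_vec m) \<le> (32 * n ^ 3 * sqrt (real CARD('n)) * N powr (1 - 1 / n) / R)\<^sup>2"
    using gram_det_le[of "real_vec a" \<delta>] by (simp add: gr N_def)
  \<comment> \<open>If \<open>m\<close> were parallel to \<open>a\<close>, then
    \<open>\<delta>\<close> would be a multiple of \<open>a\<close> vanishing at \<open>k\<close>,
    hence 0. Then \<open>q\<close> divides every \<open>h * a $ i\<close>, and primitivity yields
    \<open>q dvd h\<close>, impossible for \<open>0 < h < q\<close>.\<close>
  have lower: "gram_det (real_vec a) (int_vec m) \<noteq> 0"
  proof
    assume "gram_det (real_vec a) (int_vec m) = 0"
    hence eq: "(real_vec a \<bullet> real_vec a) *\<^sub>R \<delta> = (real_vec a \<bullet> \<delta>) *\<^sub>R real_vec a"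
      unfolding gr by (rule gram_det_eq_0)
    hence "(real_vec a \<bullet> real_vec a) * \<delta> $ k = (real_vec a \<bullet> \<delta>) * real_vec a $ k"
      by (metis vector_scaleR_component real_scaleR_def)
    hence "real_vec a \<bullet> \<delta> = 0" using \<delta>k pos[of k] by (simp add: real_vec_def)
    moreover have "real_vec a \<bullet> real_vec a \<noteq> 0" using N1 by (auto simp: N_def)
    ultimately have "\<delta> = 0" using eq by simp
    have dvd: "int q dvd int h * int (a $ i)" for i
    proof -
      have "t h i = of_int (round (t h i))" using \<delta>i[of i] \<open>\<delta> = 0\<close> by simp
      hence "real h * real (a $ i) = real q * of_int (round (t h i))"
        using q0 by (simp add: t_def field_simps)
      hence "real_of_int (int h * int (a $ i)) = real_of_int (int q * round (t h i))" by simp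
      hence "int h * int (a $ i) = int q * round (t h i)" by (simp only: of_int_eq_iff)
      thus ?thesis by simp
    qed
    obtain c :: "'n \<Rightarrow> int" where c: "(\<Sum>i\<in>UNIV. c i * int (a $ i)) = 1"
      using primitive_combination[OF prim] by blast
    have "int q dvd (\<Sum>i\<in>UNIV. c i * (int h * int (a $ i)))" by (rule dvd_sum, rule dvd_mult, rule dvd)
    also have "(\<Sum>i\<in>UNIV. c i * (int h * int (a $ i))) = int h * (\<Sum>i\<in>UNIV. c i * int (a $ i))"
      by (simp add: sum_distrib_left mult_ac)
    finally have "q dvd h" using c by simp
    thus False using h(1,2) by (simp add: nat_dvd_not_less)
  qed
  \<comment> \<open>Rounding \<open>h / q < 1\<close> times a natural number cannot exceed that
    number, so \<open>m\<close> is bounded by \<open>a\<close> coordinatewise.\<close>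
  have "norm (int_vec m) \<le> norm (real_vec a)"
  proof (rule norm_le_componentwise_cart)
    fix i
    have "0 \<le> t h i" by (simp add: t_def)
    moreover have "t h i \<le> real (a $ i)"
    proof -
      have "real h * real (a $ i) \<le> real q * real (a $ i)" using h(2) by (intro mult_right_mono) auto
      thus ?thesis using q0 by (simp add: t_def divide_simps mult.commute)
    qed
    ultimately have "0 \<le> round (t h i)" "round (t h i) \<le> int (a $ i)"
      using round_mono[of 0 "t h i"] round_mono[of "t h i" "real (a $ i)"] by simp_all
    thus "norm (int_vec m $ i) \<le> norm (real_vec a $ i)"
      by (simp add: int_vec_def m_def real_vec_def)
  qed
  thus ?thesis using upper lower gram_det_nonneg[of "real_vec a" "int_vec m"]
    unfolding N_def by (intro exI[of _ m]) auto
qed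

section \<open>Counting integer vectors close to a line\<close>

lemma card_vec_box:
  fixes S :: "'n::finite \<Rightarrow> 'a set"
  assumes "\<And>i. finite (S i)"
  shows "finite {v :: 'a ^ 'n. \<forall>i. v $ i \<in> S i}"
    and "card {v :: 'a ^ 'n. \<forall>i. v $ i \<in> S i} = (\<Prod>i\<in>UNIV. card (S i))"
proof -
  have eq: "{v :: 'a ^ 'n. \<forall>i. v $ i \<in> S i} = vec_lambda ` (PiE UNIV S)"
  proof (intro equalityI subsetI)
    fix v :: "'a ^ 'n" assume "v \<in> {v. \<forall>i. v $ i \<in> S i}"
    thus "v \<in> vec_lambda ` (PiE UNIV S)"
      by (intro image_eqI[of _ _ "($) v"]) auto
  qed auto
  have inj: "inj_on vec_lambda (PiE UNIV S)" by (auto simp: inj_on_def vec_lambda_inject)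
  have fin: "finite (PiE UNIV S)" using assms by (intro finite_PiE) auto
  show "finite {v :: 'a ^ 'n. \<forall>i. v $ i \<in> S i}" unfolding eq using fin by simp
  show "card {v :: 'a ^ 'n. \<forall>i. v $ i \<in> S i} = (\<Prod>i\<in>UNIV. card (S i))"
    unfolding eq card_image[OF inj] by (rule card_PiE) simp
qed

lemma card_UN_le_mult:
  assumes "finite A" "\<And>x. x \<in> A \<Longrightarrow> finite (B x)" "\<And>x. x \<in> A \<Longrightarrow> real (card (B x)) \<le> c"
  shows "real (card (\<Union>x\<in>A. B x)) \<le> real (card A) * c"
proof -
  have "real (card (\<Union>x\<in>A. B x)) \<le> real (\<Sum>x\<in>A. card (B x))"
    using card_UN_le[OF assms(1), of B] by (simp only: of_nat_le_iff)
  also have "\<dots> \<le> (\<Sum>x\<in>A. c)" using assms(3) by (simp add: sum_mono del: sum_constant)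
  finally show ?thesis by simp
qed

text \<open>The hypothesis says that the bound is nonnegative, which settles intervals without
  integers.\<close>

lemma card_int_interval:
  assumes "x \<le> y + 1"
  shows "finite {t::int. x \<le> of_int t \<and> of_int t \<le> (y::real)}"
    and "real (card {t::int. x \<le> of_int t \<and> of_int t \<le> y}) \<le> y - x + 1"
proof -
  have eq: "{t::int. x \<le> of_int t \<and> of_int t \<le> y} = {\<lceil>x\<rceil>..\<lfloor>y\<rfloor>}"
    by (auto simp: ceiling_le_iff le_floor_iff)
  show "finite {t::int. x \<le> of_int t \<and> of_int t \<le> (y::real)}" unfolding eq by simp
  show "real (card {t::int. x \<le> of_int t \<and> of_int t \<le> y}) \<le> y - x + 1"
  proof (cases "\<lceil>x\<rceil> \<le> \<lfloor>y\<rfloor>")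
    case True
    hence "real (card {\<lceil>x\<rceil>..\<lfloor>y\<rfloor>}) = of_int \<lfloor>y\<rfloor> - of_int \<lceil>x\<rceil> + 1" by simp
    also have "\<dots> \<le> y - x + 1" by linarith
    finally show ?thesis unfolding eq .
  qed (use assms in \<open>simp add: eq\<close>)
qed

text \<open>The solutions fill an interval of length \<open>\<gamma> / \<bar>\<alpha>\<bar>\<close>.
  The factor 2 is that of the reduction condition on a basis.\<close>

lemma card_int_affine:
  fixes \<alpha> c \<gamma> :: real
  assumes \<alpha>: "\<alpha> \<noteq> 0" and \<gamma>: "\<gamma> \<ge> 0"
  shows "finite {t::int. 2 * \<bar>\<alpha> * of_int t + c\<bar> \<le> \<gamma>}"
    and "real (card {t::int. 2 * \<bar>\<alpha> * of_int t + c\<bar> \<le> \<gamma>}) \<le> \<gamma> / \<bar>\<alpha>\<bar> + 1"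
proof -
  let ?x = "- c / \<alpha> - \<gamma> / (2 * \<bar>\<alpha>\<bar>)" and ?y = "- c / \<alpha> + \<gamma> / (2 * \<bar>\<alpha>\<bar>)"
  let ?T = "{t::int. ?x \<le> of_int t \<and> of_int t \<le> ?y}"
  have sub: "{t::int. 2 * \<bar>\<alpha> * of_int t + c\<bar> \<le> \<gamma>} \<subseteq> ?T"
  proof
    fix t :: int assume "t \<in> {t::int. 2 * \<bar>\<alpha> * of_int t + c\<bar> \<le> \<gamma>}"
    hence "2 * \<bar>\<alpha> * of_int t + c\<bar> \<le> \<gamma>" by simp
    also have "\<alpha> * of_int t + c = \<alpha> * (of_int t + c / \<alpha>)" using \<alpha> by (simp add: field_simps)
    finally have "\<bar>of_int t + c / \<alpha>\<bar> \<le> \<gamma> / (2 * \<bar>\<alpha>\<bar>)"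
      using \<alpha> unfolding abs_mult by (subst pos_le_divide_eq) (simp_all add: mult_ac)
    thus "t \<in> ?T" by (simp add: abs_le_iff)
  qed
  have nn: "\<gamma> / (2 * \<bar>\<alpha>\<bar>) \<ge> 0" using \<gamma> by simp
  have xy: "?x \<le> ?y + 1" using nn by linarith
  show "finite {t::int. 2 * \<bar>\<alpha> * of_int t + c\<bar> \<le> \<gamma>}"
    by (rule finite_subset[OF sub card_int_interval(1)[OF xy]])
  have "real (card {t::int. 2 * \<bar>\<alpha> * of_int t + c\<bar> \<le> \<gamma>}) \<le> real (card ?T)"
    using card_mono[OF card_int_interval(1)[OF xy] sub] by simp
  also have "\<dots> \<le> ?y - ?x + 1" by (rule card_int_interval(2)[OF xy])
  also have "\<dots> = \<gamma> / \<bar>\<alpha>\<bar> + 1" using \<alpha> by (simp add: field_simps)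
  finally show "real (card {t::int. 2 * \<bar>\<alpha> * of_int t + c\<bar> \<le> \<gamma>}) \<le> \<gamma> / \<bar>\<alpha>\<bar> + 1" .
qed

text \<open>For \<open>Y \<ge> 1\<close> the bound \<open>2 * Y + 1\<close> is absorbed into
  \<open>3 * Y\<close>, which keeps the later bounds monomial.\<close>

lemma card_int_abs_le:
  assumes "Y \<ge> 1"
  shows "finite {t::int. \<bar>of_int t\<bar> \<le> (Y::real)}"
    and "real (card {t::int. \<bar>of_int t\<bar> \<le> Y}) \<le> 3 * Y"
proof -
  have "{t::int. \<bar>of_int t\<bar> \<le> Y} = {t. 2 * \<bar>1 * of_int t + 0\<bar> \<le> 2 * Y}" by auto
  thus "finite {t::int. \<bar>of_int t\<bar> \<le> (Y::real)}" "real (card {t::int. \<bar>of_int t\<bar> \<le> Y}) \<le> 3 * Y"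
    using card_int_affine[of 1 "2 * Y" 0] assms by auto
qed

lemma abs_int_vec_component_le: "\<bar>of_int (v $ i)\<bar> \<le> norm (int_vec v)"
  using component_le_norm_cart[of "int_vec v" i] by (simp add: int_vec_def)

lemma card_int_vec_ball:
  assumes "Y \<ge> 1"
  shows "finite {v :: int ^ 'n::finite. norm (int_vec v) \<le> Y}"
    and "real (card {v :: int ^ 'n::finite. norm (int_vec v) \<le> Y}) \<le> (3 * Y) ^ CARD('n)"
proof -
  let ?B = "{v :: int ^ 'n. \<forall>i. v $ i \<in> {t. \<bar>of_int t\<bar> \<le> Y}}"
  have sub: "{v :: int ^ 'n. norm (int_vec v) \<le> Y} \<subseteq> ?B"
    using abs_int_vec_component_le order_trans by blast
  have fin: "finite ?B" by (rule card_vec_box(1)) (rule card_int_abs_le(1)[OF assms])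
  thus "finite {v :: int ^ 'n::finite. norm (int_vec v) \<le> Y}" using sub by (rule finite_subset[rotated])
  have "real (card {v :: int ^ 'n. norm (int_vec v) \<le> Y}) \<le> real (card ?B)"
    using card_mono[OF fin sub] by simp
  also have "\<dots> = real (card {t::int. \<bar>of_int t\<bar> \<le> Y}) ^ CARD('n)"
    by (subst card_vec_box(2)) (simp_all add: card_int_abs_le(1)[OF assms])
  also have "\<dots> \<le> (3 * Y) ^ CARD('n)" by (intro power_mono card_int_abs_le(2) assms) auto
  finally show "real (card {v :: int ^ 'n::finite. norm (int_vec v) \<le> Y}) \<le> (3 * Y) ^ CARD('n)" .
qed

lemma norm_int_vec_ge_one:
  assumes "v \<noteq> 0"
  shows "norm (int_vec v) \<ge> 1"
proof -
  obtain i where "v $ i \<noteq> 0" using assms by (auto simp: vec_eq_iff)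
  hence "(1::real) \<le> \<bar>of_int (v $ i)\<bar>" by linarith
  thus ?thesis using abs_int_vec_component_le[of v i] by linarith
qed

text \<open>The slab condition replaces one factor \<open>Y\<close> of the trivial bound by \<open>norm b\<close>: along
  a large coordinate of \<open>b\<close>, \<open>v\<close> is confined to \<open>O(norm b)\<close> integers once its other coordinates
  are fixed. Without this saving the sum over reduced pairs would lose a logarithm.\<close>

lemma card_int_vec_slab:
  fixes b :: "int ^ 'n::finite"
  assumes b: "b \<noteq> 0" and Y: "Y \<ge> 1"
  defines "S \<equiv> {v :: int ^ 'n. norm (int_vec v) \<le> Y \<and> 2 * \<bar>int_vec b \<bullet> int_vec v\<bar> \<le> (norm (int_vec b))\<^sup>2}"
  shows "finite S" and "real (card S) \<le> (3 * Y) ^ (CARD('n) - 1) * ((real CARD('n) + 1) * norm (int_vec b))"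
proof -
  define \<beta> where "\<beta> = norm (int_vec b)"
  have \<beta>1: "\<beta> \<ge> 1" using norm_int_vec_ge_one[OF b] by (simp add: \<beta>_def)
  show "finite S" unfolding S_def by (rule finite_subset[OF _ card_int_vec_ball(1)[OF Y]]) auto
  \<comment> \<open>The sum of the absolute values of the coordinates is at least the Euclidean
    norm, so one of them is at least \<open>\<beta> / d\<close>.\<close>
  obtain k where k: "\<beta> \<le> real CARD('n) * \<bar>of_int (b $ k)\<bar>"
  proof (rule ccontr)
    assume "\<not> thesis"
    hence no: "\<And>k. real CARD('n) * \<bar>of_int (b $ k)\<bar> < \<beta>" using that by (meson not_le)
    have "\<beta> \<le> (\<Sum>i\<in>UNIV. \<bar>int_vec b $ i\<bar>)" unfolding \<beta>_def by (rule norm_le_l1_cart)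
    also have "\<dots> < (\<Sum>i\<in>(UNIV :: 'n set). \<beta> / real CARD('n))"
      using no by (intro sum_strict_mono) (auto simp: int_vec_def pos_less_divide_eq mult.commute)
    finally show False by simp
  qed
  define \<alpha> :: real where "\<alpha> = of_int (b $ k)"
  have \<alpha>0: "\<alpha> \<noteq> 0" using k \<beta>1 by (auto simp: \<alpha>_def)
  \<comment> \<open>\<open>W\<close> holds the coordinates other than \<open>k\<close>, with 0
    stored at \<open>k\<close>; for fixed \<open>w\<close> the slab condition becomes the affine
    inequality \<open>J w\<close> for the coordinate \<open>k\<close>.\<close>
  define W where "W = {w :: int ^ 'n. \<forall>i. w $ i \<in> (if i = k then {0} else {t. \<bar>of_int t\<bar> \<le> Y})}"
  define J where "J w = {t::int. 2 * \<bar>\<alpha> * of_int t + int_vec b \<bullet> int_vec w\<bar> \<le> \<beta>\<^sup>2}" for w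
  define upd where "upd w t = (\<chi> i. if i = k then t else w $ i)" for w :: "int ^ 'n" and t :: int
  have finW: "finite W" unfolding W_def by (rule card_vec_box(1)) (simp add: card_int_abs_le(1)[OF Y])
  have "card W = (\<Prod>i\<in>UNIV. card (if i = k then {0} else {t::int. \<bar>of_int t\<bar> \<le> Y}))"
    unfolding W_def by (rule card_vec_box(2)) (simp add: card_int_abs_le(1)[OF Y])
  also have "\<dots> = card {t::int. \<bar>of_int t\<bar> \<le> Y} ^ (CARD('n) - 1)"
    by (subst prod.remove[of UNIV k]) (auto simp: card_Diff_singleton)
  finally have "real (card W) = real (card {t::int. \<bar>of_int t\<bar> \<le> Y}) ^ (CARD('n) - 1)" by simp
  also have "\<dots> \<le> (3 * Y) ^ (CARD('n) - 1)" by (intro power_mono card_int_abs_le(2) Y) auto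
  finally have cardW: "real (card W) \<le> (3 * Y) ^ (CARD('n) - 1)" .
  have finJ: "finite (J w)" for w unfolding J_def by (rule card_int_affine(1)[OF \<alpha>0]) simp
  have cardJ: "real (card (J w)) \<le> (real CARD('n) + 1) * \<beta>" for w
  proof -
    have "real (card (J w)) \<le> \<beta>\<^sup>2 / \<bar>\<alpha>\<bar> + 1" unfolding J_def by (rule card_int_affine(2)[OF \<alpha>0]) simp
    also have "\<beta>\<^sup>2 / \<bar>\<alpha>\<bar> \<le> real CARD('n) * \<beta>"
    proof -
      have "\<beta> * \<beta> \<le> (real CARD('n) * \<bar>\<alpha>\<bar>) * \<beta>" using k \<beta>1 by (intro mult_right_mono) (auto simp: \<alpha>_def)
      thus ?thesis using \<alpha>0 by (simp add: divide_simps power2_eq_square mult_ac)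
    qed
    finally show ?thesis using \<beta>1 by (simp add: algebra_simps)
  qed
  have sub: "S \<subseteq> (\<Union>w\<in>W. upd w ` J w)"
  proof
    fix v assume v: "v \<in> S"
    let ?w = "upd v 0"
    have "?w \<in> W"
    proof -
      have "\<bar>of_int (v $ i)\<bar> \<le> Y" for i
        using v abs_int_vec_component_le[of v i] unfolding S_def by auto
      thus ?thesis by (simp add: W_def upd_def)
    qed
    moreover have "v $ k \<in> J ?w"
    proof -
      have "int_vec b \<bullet> int_vec v = \<alpha> * of_int (v $ k) + (\<Sum>i\<in>UNIV - {k}. of_int (b $ i) * of_int (v $ i))"
        unfolding inner_vec_def \<alpha>_def by (subst sum.remove[of UNIV k]) (auto simp: int_vec_def)
      moreover have "int_vec b \<bullet> int_vec ?w = (\<Sum>i\<in>UNIV - {k}. of_int (b $ i) * of_int (v $ i))"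
        unfolding inner_vec_def by (subst sum.remove[of UNIV k]) (auto simp: int_vec_def upd_def)
      ultimately show ?thesis using v by (simp add: J_def S_def \<beta>_def)
    qed
    moreover have "v = upd ?w (v $ k)" by (simp add: upd_def vec_eq_iff)
    ultimately show "v \<in> (\<Union>w\<in>W. upd w ` J w)" by blast
  qed
  have "real (card S) \<le> real (card (\<Union>w\<in>W. upd w ` J w))"
    using sub finW finJ by (simp add: card_mono)
  also have "\<dots> \<le> real (card W) * ((real CARD('n) + 1) * \<beta>)"
  proof (rule card_UN_le_mult)
    fix w
    show "real (card (upd w ` J w)) \<le> (real CARD('n) + 1) * \<beta>"
      using card_image_le[OF finJ, of "upd w" w] cardJ[of w] by linarith
  qed (use finW finJ in auto)
  also have "\<dots> \<le> (3 * Y) ^ (CARD('n) - 1) * ((real CARD('n) + 1) * \<beta>)"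
    using cardW \<beta>1 by (intro mult_right_mono) auto
  finally show "real (card S) \<le> (3 * Y) ^ (CARD('n) - 1) * ((real CARD('n) + 1) * norm (int_vec b))"
    by (simp add: \<beta>_def)
qed

section \<open>Reduced bases of two-dimensional lattices and their dyadic count\<close>

lemma int_vec_add: "int_vec (u + v) = int_vec u + int_vec v"
  by (simp add: int_vec_def vec_eq_iff)

lemma int_vec_scale: "int_vec (c *s v) = of_int c *\<^sub>R int_vec v"
  by (simp add: int_vec_def vec_eq_iff)

lemma int_vec_0 [simp]: "int_vec 0 = 0"
  by (simp add: int_vec_def vec_eq_iff)

text \<open>Among the pairs with the given Gram determinant that generate \<open>u\<close>, one
  minimises the natural number \<open>norm b ^ 2 + norm c ^ 2\<close>. Comparison with the pairs
  \<open>b, c + b\<close> and \<open>b, c - b\<close> gives the reduction inequality, comparison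
  with \<open>u, v\<close> the last bound.\<close>

lemma gauss_reduced_basis:
  fixes u v :: "int ^ 'n::finite"
  obtains b c :: "int ^ 'n" and x y :: int where
    "gram_det (int_vec b) (int_vec c) = gram_det (int_vec u) (int_vec v)"
    "u = x *s b + y *s c"
    "norm (int_vec b) \<le> norm (int_vec c)"
    "2 * \<bar>int_vec b \<bullet> int_vec c\<bar> \<le> (norm (int_vec b))\<^sup>2"
    "(norm (int_vec b))\<^sup>2 + (norm (int_vec c))\<^sup>2 \<le> (norm (int_vec u))\<^sup>2 + (norm (int_vec v))\<^sup>2"
proof -
  define P where "P b c \<longleftrightarrow> gram_det (int_vec b) (int_vec c) = gram_det (int_vec u) (int_vec v) \<and>
    (\<exists>x y. u = x *s b + y *s c)" for b c :: "int ^ 'n"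
  define f where "f b c = nat (\<Sum>i\<in>UNIV. (b $ i)\<^sup>2 + (c $ i)\<^sup>2)" for b c :: "int ^ 'n"
  have f: "real (f b c) = (norm (int_vec b))\<^sup>2 + (norm (int_vec c))\<^sup>2" for b c
  proof -
    have "real (f b c) = of_int (\<Sum>i\<in>UNIV. (b $ i)\<^sup>2 + (c $ i)\<^sup>2)"
      unfolding f_def by (simp add: sum_nonneg)
    also have "\<dots> = (norm (int_vec b))\<^sup>2 + (norm (int_vec c))\<^sup>2"
      unfolding power2_norm_eq_inner by (simp add: inner_vec_def int_vec_def power2_eq_square sum.distrib)
    finally show ?thesis .
  qed
  have "P u v" unfolding P_def by (intro conjI exI[of _ 1] exI[of _ 0]) auto
  then obtain p where p: "P (fst p) (snd p)" "\<And>b c. P b c \<Longrightarrow> f (fst p) (snd p) \<le> f b c"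
    using ex_has_least_nat[of "\<lambda>p. P (fst p) (snd p)" "(u, v)" "\<lambda>p. f (fst p) (snd p)"] by auto
  have swap: "P c b" if "P b c" for b c
    using that unfolding P_def by (metis gram_det_commute add.commute)
  obtain b c where bc: "P b c" "\<And>b' c'. P b' c' \<Longrightarrow> f b c \<le> f b' c'" "norm (int_vec b) \<le> norm (int_vec c)"
  proof (cases "norm (int_vec (fst p)) \<le> norm (int_vec (snd p))")
    case False
    have "f (snd p) (fst p) = f (fst p) (snd p)" by (simp add: f_def add.commute)
    thus ?thesis using that[of "snd p" "fst p"] swap[OF p(1)] p(2) False by simp
  qed (use that p in blast)
  have step: "2 * (- of_int e * (int_vec b \<bullet> int_vec c)) \<le> (norm (int_vec b))\<^sup>2" if e: "e = 1 \<or> e = -1" for e :: int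
  proof -
    obtain x y where xy: "u = x *s b + y *s c" using bc(1) by (auto simp: P_def)
    have "P b (c + e *s b)" unfolding P_def
    proof
      show "gram_det (int_vec b) (int_vec (c + e *s b)) = gram_det (int_vec u) (int_vec v)"
        using bc(1) by (simp add: P_def int_vec_add int_vec_scale gram_det_shear)
      have "u = (x - y * e) *s b + y *s (c + e *s b)"
        unfolding xy by (simp add: vec_eq_iff algebra_simps)
      thus "\<exists>x y. u = x *s b + y *s (c + e *s b)" by blast
    qed
    hence "real (f b c) \<le> real (f b (c + e *s b))" using bc(2) by simp
    hence "int_vec c \<bullet> int_vec c \<le> (int_vec c + of_int e *\<^sub>R int_vec b) \<bullet> (int_vec c + of_int e *\<^sub>R int_vec b)"
      unfolding f by (simp add: int_vec_add int_vec_scale power2_norm_eq_inner)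
    also have "\<dots> = int_vec c \<bullet> int_vec c + 2 * of_int e * (int_vec b \<bullet> int_vec c) + (of_int e)\<^sup>2 * (int_vec b \<bullet> int_vec b)"
      by (simp add: inner_add_left inner_add_right inner_commute power2_eq_square algebra_simps)
    also have "(of_int e :: real)\<^sup>2 = 1" using e by auto
    finally show ?thesis by (simp add: power2_norm_eq_inner)
  qed
  have red: "2 * \<bar>int_vec b \<bullet> int_vec c\<bar> \<le> (norm (int_vec b))\<^sup>2"
    using step[of 1] step[of "-1"] by (simp add: abs_if)
  obtain x y where xy: "u = x *s b + y *s c" using bc(1) by (auto simp: P_def)
  have "real (f b c) \<le> real (f u v)" using bc(2)[OF \<open>P u v\<close>] by simp
  thus ?thesis using that[OF _ xy bc(3) red] bc(1) unfolding f P_def by blast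
qed

text \<open>The coefficient ranges are those forced by a reduced basis on a vector of norm at most
  \<open>U\<close>, so for such a basis the image contains every lattice vector of that
  size.\<close>

definition lattice_box :: "real \<Rightarrow> int ^ 'n \<Rightarrow> int ^ 'n \<Rightarrow> (int ^ 'n::finite) set" where
  "lattice_box U b c = (\<lambda>(x, y). x *s b + y *s c) `
     ({x. \<bar>of_int x\<bar> \<le> 2 * U / norm (int_vec b)} \<times> {y. \<bar>of_int y\<bar> \<le> 2 * U / norm (int_vec c)})"

text \<open>The bounds \<open>2 * U\<close> on both lengths make each coefficient range at least 1,
  so the monomial count applies; \<open>36\<close> is \<open>(3 * 2)^2\<close>.\<close>

lemma card_lattice_box:
  fixes b c :: "int ^ 'n::finite"
  assumes "b \<noteq> 0" "c \<noteq> 0" "norm (int_vec b) \<le> 2 * U" "norm (int_vec c) \<le> 2 * U"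
  shows "finite (lattice_box U b c)"
    and "real (card (lattice_box U b c)) \<le> 36 * U\<^sup>2 / (norm (int_vec b) * norm (int_vec c))"
proof -
  have n: "norm (int_vec b) \<ge> 1" "norm (int_vec c) \<ge> 1" using assms norm_int_vec_ge_one by auto
  have Y1: "2 * U / norm (int_vec b) \<ge> 1" using n(1) assms(3) by (subst pos_le_divide_eq) linarith+
  have Y2: "2 * U / norm (int_vec c) \<ge> 1" using n(2) assms(4) by (subst pos_le_divide_eq) linarith+
  let ?X = "{x::int. \<bar>of_int x\<bar> \<le> 2 * U / norm (int_vec b)}"
  let ?Y = "{y::int. \<bar>of_int y\<bar> \<le> 2 * U / norm (int_vec c)}"
  have fin: "finite (?X \<times> ?Y)" using card_int_abs_le(1)[OF Y1] card_int_abs_le(1)[OF Y2] by simp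
  show "finite (lattice_box U b c)" unfolding lattice_box_def using fin by simp
  have "real (card (lattice_box U b c)) \<le> real (card ?X) * real (card ?Y)"
    unfolding lattice_box_def using card_image_le[OF fin, of "\<lambda>(x, y). x *s b + y *s c"]
    by (simp only: card_cartesian_product of_nat_mult[symmetric] of_nat_le_iff)
  also have "\<dots> \<le> (3 * (2 * U / norm (int_vec b))) * (3 * (2 * U / norm (int_vec c)))"
    using Y1 Y2 by (intro mult_mono card_int_abs_le(2)) auto
  also have "\<dots> = 36 * U\<^sup>2 / (norm (int_vec b) * norm (int_vec c))"
    by (simp add: power2_eq_square)
  finally show "real (card (lattice_box U b c)) \<le> 36 * U\<^sup>2 / (norm (int_vec b) * norm (int_vec c))" .
qed

text \<open>For a reduced basis the mixed term of the quadratic form is at most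
  \<open>(X * \<beta>) * (Y * \<gamma>)\<close>, hence at most half the sum of the two squares. So
  these squares sum to at most \<open>2 * norm u ^ 2\<close>.\<close>

lemma mem_lattice_box:
  fixes b c :: "int ^ 'n::finite"
  assumes u: "u = x *s b + y *s c" and U: "norm (int_vec u) \<le> U"
    and le: "norm (int_vec b) \<le> norm (int_vec c)" and b0: "b \<noteq> 0"
    and red: "2 * \<bar>int_vec b \<bullet> int_vec c\<bar> \<le> (norm (int_vec b))\<^sup>2"
  shows "u \<in> lattice_box U b c"
proof -
  define \<beta> \<gamma> where "\<beta> = norm (int_vec b)" and "\<gamma> = norm (int_vec c)"
  define X Y where "X = \<bar>of_int x :: real\<bar>" and "Y = \<bar>of_int y :: real\<bar>"
  have \<beta>\<gamma>: "\<beta> \<ge> 1" "\<gamma> \<ge> 1" "\<beta> \<le> \<gamma>"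
    using norm_int_vec_ge_one[OF b0] le by (auto simp: \<beta>_def \<gamma>_def)
  have XY: "X \<ge> 0" "Y \<ge> 0" by (auto simp: X_def Y_def)
  have "(norm (int_vec u))\<^sup>2 = X\<^sup>2 * \<beta>\<^sup>2 + 2 * (of_int x * of_int y * (int_vec b \<bullet> int_vec c)) + Y\<^sup>2 * \<gamma>\<^sup>2"
    unfolding u \<beta>_def \<gamma>_def power2_norm_eq_inner X_def Y_def
    by (simp add: int_vec_add int_vec_scale inner_add_left inner_add_right inner_commute power2_eq_square algebra_simps)
  moreover have "\<bar>2 * (of_int x * of_int y * (int_vec b \<bullet> int_vec c))\<bar> \<le> X * Y * \<beta>\<^sup>2"
  proof -
    have "\<bar>2 * (of_int x * of_int y * (int_vec b \<bullet> int_vec c))\<bar> = X * Y * (2 * \<bar>int_vec b \<bullet> int_vec c\<bar>)"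
      by (simp add: X_def Y_def abs_mult)
    also have "\<dots> \<le> X * Y * \<beta>\<^sup>2" using red XY by (intro mult_left_mono) (auto simp: \<beta>_def)
    finally show ?thesis .
  qed
  moreover have "X * Y * \<beta>\<^sup>2 \<le> (X * \<beta>) * (Y * \<gamma>)"
  proof -
    have "X * Y * \<beta> * \<beta> \<le> X * Y * \<beta> * \<gamma>" using XY \<beta>\<gamma> by (intro mult_left_mono) auto
    thus ?thesis by (simp add: power2_eq_square mult_ac)
  qed
  moreover have "2 * ((X * \<beta>) * (Y * \<gamma>)) \<le> (X * \<beta>)\<^sup>2 + (Y * \<gamma>)\<^sup>2"
    using sum_squares_bound[of "X * \<beta>" "Y * \<gamma>"] by (simp add: mult.assoc)
  moreover have "(norm (int_vec u))\<^sup>2 \<le> U\<^sup>2" using U by (intro power_mono) auto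
  ultimately have "(X * \<beta>)\<^sup>2 + (Y * \<gamma>)\<^sup>2 \<le> 2 * U\<^sup>2" by (simp add: power_mult_distrib)
  also have "2 * U\<^sup>2 \<le> (2 * U)\<^sup>2" by (simp add: power_mult_distrib)
  finally have le: "(X * \<beta>)\<^sup>2 + (Y * \<gamma>)\<^sup>2 \<le> (2 * U)\<^sup>2" .
  have U0: "2 * U \<ge> 0" using U norm_ge_zero[of "int_vec u"] by linarith
  have "(X * \<beta>)\<^sup>2 \<le> (2 * U)\<^sup>2" using le zero_le_power2[of "Y * \<gamma>"] by linarith
  moreover have "(Y * \<gamma>)\<^sup>2 \<le> (2 * U)\<^sup>2" using le zero_le_power2[of "X * \<beta>"] by linarith
  ultimately have "X * \<beta> \<le> 2 * U" "Y * \<gamma> \<le> 2 * U" using power2_le_imp_le U0 by blast+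
  hence "X \<le> 2 * U / \<beta>" "Y \<le> 2 * U / \<gamma>" using \<beta>\<gamma> by (simp_all add: pos_le_divide_eq)
  thus ?thesis unfolding lattice_box_def u
    by (intro image_eqI[of _ _ "(x, y)"]) (auto simp: X_def Y_def \<beta>_def \<gamma>_def)
qed

text \<open>Dyadic shells: within one set both lengths are fixed up to a factor 2, so the later sums
  are geometric in \<open>i\<close> and \<open>j\<close>.\<close>

definition reduced_pairs :: "real \<Rightarrow> nat \<Rightarrow> nat \<Rightarrow> ((int ^ 'n::finite) \<times> (int ^ 'n)) set" where
  "reduced_pairs U i j = {(b, c). 2 ^ i \<le> norm (int_vec b) \<and> norm (int_vec b) < 2 ^ (i + 1) \<and>
     2 ^ j \<le> norm (int_vec c) \<and> norm (int_vec c) < 2 ^ (j + 1) \<and>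
     norm (int_vec b) \<le> 2 * U \<and> norm (int_vec c) \<le> 2 * U \<and>
     2 * \<bar>int_vec b \<bullet> int_vec c\<bar> \<le> (norm (int_vec b))\<^sup>2}"

text \<open>\<open>b\<close> ranges over a ball, and for each \<open>b\<close> the reduction
  inequality puts \<open>c\<close> into a slab, whose thickness gives the final factor
  \<open>2 ^ (i + 1)\<close>.\<close>

lemma card_reduced_pairs:
  fixes U :: real
  defines "d \<equiv> CARD('n)"
  shows "finite (reduced_pairs U i j :: ((int ^ 'n::finite) \<times> (int ^ 'n)) set)"
    and "real (card (reduced_pairs U i j :: ((int ^ 'n) \<times> (int ^ 'n)) set)) \<le>
      (3 * 2 ^ (i + 1)) ^ d * ((3 * 2 ^ (j + 1)) ^ (d - 1) * ((real d + 1) * 2 ^ (i + 1)))"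
proof -
  let ?P = "reduced_pairs U i j :: ((int ^ 'n) \<times> (int ^ 'n)) set"
  define B where "B = {b :: int ^ 'n. b \<noteq> 0 \<and> norm (int_vec b) \<le> 2 ^ (i + 1)}"
  define C where "C b = {c :: int ^ 'n. norm (int_vec c) \<le> 2 ^ (j + 1) \<and>
      2 * \<bar>int_vec b \<bullet> int_vec c\<bar> \<le> (norm (int_vec b))\<^sup>2}" for b :: "int ^ 'n"
  have one: "(1::real) \<le> 2 ^ (m + 1)" for m by (rule one_le_power) simp
  have finball: "finite {b :: int ^ 'n. norm (int_vec b) \<le> 2 ^ (i + 1)}"
    by (rule card_int_vec_ball(1)[OF one])
  have finB: "finite B" unfolding B_def by (rule finite_subset[OF _ finball]) auto
  have "real (card B) \<le> real (card {b :: int ^ 'n. norm (int_vec b) \<le> 2 ^ (i + 1)})"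
    unfolding B_def using finball by (intro of_nat_mono card_mono) auto
  also have "\<dots> \<le> (3 * 2 ^ (i + 1)) ^ d" unfolding d_def by (rule card_int_vec_ball(2)[OF one])
  finally have cardB: "real (card B) \<le> (3 * 2 ^ (i + 1)) ^ d" .
  have finC: "finite (C b)" if "b \<in> B" for b
    unfolding C_def using that one by (intro card_int_vec_slab(1)) (auto simp: B_def)
  have cardC: "real (card (C b)) \<le> (3 * 2 ^ (j + 1)) ^ (d - 1) * ((real d + 1) * 2 ^ (i + 1))" if b: "b \<in> B" for b
  proof -
    have "real (card (C b)) \<le> (3 * 2 ^ (j + 1)) ^ (d - 1) * ((real d + 1) * norm (int_vec b))"
      unfolding C_def d_def using b one by (intro card_int_vec_slab(2)) (auto simp: B_def)
    also have "\<dots> \<le> (3 * 2 ^ (j + 1)) ^ (d - 1) * ((real d + 1) * 2 ^ (i + 1))"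
      using b by (intro mult_left_mono) (auto simp: B_def)
    finally show ?thesis .
  qed
  have sub: "?P \<subseteq> (\<Union>b\<in>B. Pair b ` C b)"
  proof
    fix p assume "p \<in> ?P"
    then obtain b c where p: "p = (b, c)" "(b, c) \<in> ?P" by (cases p) auto
    have "b \<noteq> 0"
    proof
      assume "b = 0"
      hence "(2::real) ^ i \<le> 0" using p(2) by (simp add: reduced_pairs_def)
      thus False using zero_less_power[of "2::real" i] by linarith
    qed
    hence "b \<in> B" using p by (simp add: reduced_pairs_def B_def)
    moreover have "c \<in> C b" using p by (simp add: reduced_pairs_def C_def)
    ultimately show "p \<in> (\<Union>b\<in>B. Pair b ` C b)" using p by blast
  qed
  have finU: "finite (\<Union>b\<in>B. Pair b ` C b)" using finB finC by blast
  show "finite ?P" by (rule finite_subset[OF sub finU])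
  have "real (card ?P) \<le> real (card (\<Union>b\<in>B. Pair b ` C b))" using card_mono[OF finU sub] by simp
  also have "\<dots> \<le> real (card B) * ((3 * 2 ^ (j + 1)) ^ (d - 1) * ((real d + 1) * 2 ^ (i + 1)))"
  proof (rule card_UN_le_mult[OF finB])
    fix b assume b: "b \<in> B"
    show "finite (Pair b ` C b)" using finC[OF b] by simp
    show "real (card (Pair b ` C b)) \<le> (3 * 2 ^ (j + 1)) ^ (d - 1) * ((real d + 1) * 2 ^ (i + 1))"
      using cardC[OF b] by (simp add: card_image inj_on_def)
  qed
  also have "\<dots> \<le> (3 * 2 ^ (i + 1)) ^ d * ((3 * 2 ^ (j + 1)) ^ (d - 1) * ((real d + 1) * 2 ^ (i + 1)))"
    using cardB by (intro mult_right_mono) auto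
  finally show "real (card ?P) \<le> (3 * 2 ^ (i + 1)) ^ d * ((3 * 2 ^ (j + 1)) ^ (d - 1) * ((real d + 1) * 2 ^ (i + 1)))" .
qed

lemma ex_power_two_bounds:
  fixes z :: real
  assumes "z \<ge> 1"
  obtains i :: nat where "2 ^ i \<le> z" "z < 2 ^ (i + 1)"
proof -
  define k where "k = (LEAST n. z < 2 ^ n)"
  have "\<exists>n. z < 2 ^ n" by (rule real_arch_pow) simp
  hence k: "z < 2 ^ k" unfolding k_def by (rule LeastI_ex)
  hence "k \<noteq> 0" using assms by (intro notI) simp
  then obtain i where i: "k = Suc i" using not0_implies_Suc by blast
  have "\<not> z < 2 ^ i" by (rule not_less_Least) (simp add: k_def[symmetric] i)
  thus ?thesis using k i by (intro that[of i]) auto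
qed

lemma sum_geometric_le:
  fixes x :: real
  assumes "x \<ge> 2"
  shows "(\<Sum>i\<le>m. x ^ i) \<le> 2 * x ^ m"
proof (induction m)
  case (Suc m)
  have "2 * x ^ m \<le> x ^ Suc m" using assms by simp
  thus ?case using Suc by simp
qed simp

text \<open>\<open>sqrt (gram_det u v) / norm v\<close> is the distance of \<open>u\<close> from the line through \<open>v\<close>.\<close>

definition near_lines :: "real \<Rightarrow> real \<Rightarrow> (int ^ 'n::finite) set" where
  "near_lines U X = {u. norm (int_vec u) \<le> U \<and> (\<exists>v. norm (int_vec v) \<le> U \<and>
     0 < gram_det (int_vec u) (int_vec v) \<and> gram_det (int_vec u) (int_vec v) \<le> X\<^sup>2)}"

text \<open>In a reduced basis \<open>\<bar>b \<bullet> c\<bar>\<close> is at most half of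
  \<open>norm b * norm c\<close>, so the area is comparable to that product, which is then at most
  \<open>2 * X\<close>. The index \<open>s\<close> is \<open>i + j\<close>, and
  \<open>norm b \<le> norm c\<close> gives \<open>i \<le> s div 2\<close>.\<close>

lemma near_lines_subset:
  assumes X: "X \<ge> 0" and J: "2 * X < 2 ^ (J + 1)"
  shows "near_lines U X \<subseteq> (\<Union>s\<in>{..J}. \<Union>i\<in>{..s div 2}. \<Union>(b, c)\<in>reduced_pairs U i (s - i). lattice_box U b c)"
proof
  fix u :: "int ^ 'n" assume "u \<in> near_lines U X"
  then obtain v where uv: "norm (int_vec u) \<le> U" "norm (int_vec v) \<le> U"
    "0 < gram_det (int_vec u) (int_vec v)" "gram_det (int_vec u) (int_vec v) \<le> X\<^sup>2"
    unfolding near_lines_def by blast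
  obtain b c x y where bc: "gram_det (int_vec b) (int_vec c) = gram_det (int_vec u) (int_vec v)"
    "u = x *s b + y *s c" "norm (int_vec b) \<le> norm (int_vec c)"
    "2 * \<bar>int_vec b \<bullet> int_vec c\<bar> \<le> (norm (int_vec b))\<^sup>2"
    "(norm (int_vec b))\<^sup>2 + (norm (int_vec c))\<^sup>2 \<le> (norm (int_vec u))\<^sup>2 + (norm (int_vec v))\<^sup>2"
    by (rule gauss_reduced_basis)
  define \<beta> \<gamma> where "\<beta> = norm (int_vec b)" and "\<gamma> = norm (int_vec c)"
  have b0: "b \<noteq> 0" using bc(1) uv(3) by (auto simp: gram_det_def)
  have \<beta>\<gamma>: "1 \<le> \<beta>" "\<beta> \<le> \<gamma>" using norm_int_vec_ge_one[OF b0] bc(3) by (auto simp: \<beta>_def \<gamma>_def)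
  have U0: "U \<ge> 0" using uv(1) norm_ge_zero order_trans by blast
  have "\<beta>\<^sup>2 + \<gamma>\<^sup>2 \<le> U\<^sup>2 + U\<^sup>2"
  proof -
    have "(norm (int_vec u))\<^sup>2 \<le> U\<^sup>2" "(norm (int_vec v))\<^sup>2 \<le> U\<^sup>2" using uv by (auto intro: power_mono)
    thus ?thesis using bc(5) by (simp add: \<beta>_def \<gamma>_def)
  qed
  also have "\<dots> \<le> (2 * U)\<^sup>2" by (simp add: power_mult_distrib)
  finally have "\<gamma>\<^sup>2 \<le> (2 * U)\<^sup>2" using zero_le_power2[of \<beta>] by linarith
  hence \<gamma>U: "\<gamma> \<le> 2 * U" by (rule power2_le_imp_le) (use U0 in simp)
  have "(\<beta> * \<gamma>)\<^sup>2 \<le> (2 * X)\<^sup>2"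
  proof -
    define t where "t = \<bar>int_vec b \<bullet> int_vec c\<bar>"
    have "(2 * t)\<^sup>2 \<le> (\<beta> * \<gamma>)\<^sup>2"
    proof (rule power_mono)
      have "2 * t \<le> \<beta>\<^sup>2" using bc(4) by (simp only: t_def \<beta>_def)
      also have "\<dots> = \<beta> * \<beta>" by (rule power2_eq_square)
      also have "\<dots> \<le> \<beta> * \<gamma>" using \<beta>\<gamma> by (intro mult_left_mono) auto
      finally show "2 * t \<le> \<beta> * \<gamma>" .
    qed (simp add: t_def)
    hence "4 * t\<^sup>2 \<le> (\<beta> * \<gamma>)\<^sup>2" by (simp add: power_mult_distrib)
    moreover have "(\<beta> * \<gamma>)\<^sup>2 - t\<^sup>2 \<le> X\<^sup>2"
      using uv(4) bc(1) by (simp add: gram_det_def \<beta>_def \<gamma>_def t_def power_mult_distrib power2_norm_eq_inner)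
    ultimately have "(\<beta> * \<gamma>)\<^sup>2 \<le> 4 * X\<^sup>2" using zero_le_power2[of X] by linarith
    thus ?thesis by (simp add: power_mult_distrib)
  qed
  hence \<beta>\<gamma>X: "\<beta> * \<gamma> \<le> 2 * X" by (rule power2_le_imp_le) (use X in simp)
  obtain i where i: "2 ^ i \<le> \<beta>" "\<beta> < 2 ^ (i + 1)" by (rule ex_power_two_bounds[OF \<beta>\<gamma>(1)])
  obtain j where j: "2 ^ j \<le> \<gamma>" "\<gamma> < 2 ^ (j + 1)"
    by (rule ex_power_two_bounds[OF order_trans[OF \<beta>\<gamma>]])
  have "(2::real) ^ i < 2 ^ (j + 1)" using i j \<beta>\<gamma> by linarith
  hence ij: "i \<le> j" by (subst (asm) power_strict_increasing_iff) auto
  have "(2::real) ^ (i + j) \<le> \<beta> * \<gamma>" unfolding power_add using i j \<beta>\<gamma> by (intro mult_mono) auto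
  hence "(2::real) ^ (i + j) < 2 ^ (J + 1)" using \<beta>\<gamma>X J by linarith
  hence sJ: "i + j \<le> J" by (subst (asm) power_strict_increasing_iff) auto
  have \<beta>U: "\<beta> \<le> 2 * U" using \<beta>\<gamma> \<gamma>U by linarith
  have "(b, c) \<in> reduced_pairs U i j"
    unfolding reduced_pairs_def using i j \<gamma>U \<beta>U bc(4) by (simp add: \<beta>_def \<gamma>_def)
  moreover have "u \<in> lattice_box U b c"
    by (rule mem_lattice_box[OF bc(2) uv(1) bc(3) b0 bc(4)])
  ultimately have "u \<in> (\<Union>(b, c)\<in>reduced_pairs U i (i + j - i). lattice_box U b c)" by auto
  moreover have "i \<le> (i + j) div 2" using ij by simp
  ultimately show "u \<in> (\<Union>s\<in>{..J}. \<Union>i\<in>{..s div 2}. \<Union>(b, c)\<in>reduced_pairs U i (s - i). lattice_box U b c)"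
    using sJ by blast
qed

text \<open>There are \<open>O(2 ^ (i * d) * 2 ^ (j * (d - 1)) * 2 ^ i)\<close> pairs, each with
  \<open>O(U^2 / 2 ^ (i + j))\<close> lattice vectors; the slab factor \<open>2 ^ i\<close> cancels
  against the denominator.\<close>

lemma card_reduced_lattice_boxes:
  fixes U :: real
  assumes d: "CARD('n) \<ge> 2"
  defines "S i j \<equiv> (\<Union>(b, c)\<in>reduced_pairs U i j. lattice_box U b c) :: (int ^ 'n::finite) set"
  shows "finite (S i j)"
    and "real (card (S i j)) \<le> (72 * (real CARD('n) + 1) * 6 ^ (2 * CARD('n) - 1)) * U\<^sup>2 *
      (2 ^ (i * CARD('n)) * 2 ^ (j * (CARD('n) - 2)))"
proof -
  let ?P = "reduced_pairs U i j :: ((int ^ 'n) \<times> (int ^ 'n)) set"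
  have props: "b \<noteq> 0" "c \<noteq> 0" "norm (int_vec b) \<le> 2 * U" "norm (int_vec c) \<le> 2 * U"
    "2 ^ i * 2 ^ j \<le> norm (int_vec b) * norm (int_vec c)" if "(b, c) \<in> ?P" for b c :: "int ^ 'n"
  proof -
    have ge: "2 ^ i \<le> norm (int_vec b)" "2 ^ j \<le> norm (int_vec c)"
      using that by (simp_all add: reduced_pairs_def)
    have "0 < norm (int_vec b)" by (rule less_le_trans[OF _ ge(1)]) simp
    thus "b \<noteq> 0" by auto
    have "0 < norm (int_vec c)" by (rule less_le_trans[OF _ ge(2)]) simp
    thus "c \<noteq> 0" by auto
    show "norm (int_vec b) \<le> 2 * U" "norm (int_vec c) \<le> 2 * U"
      using that by (simp_all add: reduced_pairs_def)
    show "2 ^ i * 2 ^ j \<le> norm (int_vec b) * norm (int_vec c)" using ge by (intro mult_mono) auto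
  qed
  have fin: "finite (case p of (b, c) \<Rightarrow> lattice_box U b c)" if "p \<in> ?P" for p
  proof -
    obtain b c where bc: "p = (b, c)" by (cases p)
    show ?thesis using card_lattice_box(1)[OF props(1-4)[of b c]] that by (simp add: bc)
  qed
  have bd: "real (card (case p of (b, c) \<Rightarrow> lattice_box U b c)) \<le> 36 * U\<^sup>2 / (2 ^ i * 2 ^ j)" if p: "p \<in> ?P" for p
  proof -
    obtain b c where bc: "p = (b, c)" by (cases p)
    have "real (card (lattice_box U b c)) \<le> 36 * U\<^sup>2 / (norm (int_vec b) * norm (int_vec c))"
      using card_lattice_box(2)[OF props(1-4)[of b c]] p by (simp add: bc)
    also have "\<dots> \<le> 36 * U\<^sup>2 / (2 ^ i * 2 ^ j)"
      using props(5)[of b c] p bc by (intro frac_le) auto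
    finally show ?thesis by (simp add: bc)
  qed
  show "finite (S i j)" unfolding S_def using card_reduced_pairs(1) fin by blast
  obtain e where e: "CARD('n) = e + 2" using d by (metis add.commute le_Suc_ex)
  have "real (card (S i j)) \<le> real (card ?P) * (36 * U\<^sup>2 / (2 ^ i * 2 ^ j))"
    unfolding S_def by (rule card_UN_le_mult[OF card_reduced_pairs(1) fin bd])
  also have "\<dots> \<le> ((3 * 2 ^ (i + 1)) ^ CARD('n) * ((3 * 2 ^ (j + 1)) ^ (CARD('n) - 1) * ((real CARD('n) + 1) * 2 ^ (i + 1)))) *
      (36 * U\<^sup>2 / (2 ^ i * 2 ^ j))"
    by (intro mult_right_mono card_reduced_pairs(2)) auto
  also have "\<dots> = (72 * (real CARD('n) + 1) * (6 ^ (e + 2) * 6 ^ (e + 1))) * U\<^sup>2 * ((2 ^ i) ^ (e + 2) * (2 ^ j) ^ e)"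
  proof -
    \<comment> \<open>Here \<open>p\<close> is \<open>2 ^ i\<close>, \<open>r\<close> is
      \<open>2 ^ j\<close>, \<open>k\<close> is \<open>d + 1\<close> and \<open>u\<close> is
      \<open>U^2\<close>; variables in place of the powers leave a plain cancellation of
      \<open>p * r\<close>.\<close>
    have aux: "((6 * p) ^ (e + 2) * ((6 * r) ^ (e + 1) * (k * (2 * p)))) * (36 * u / (p * r)) =
        (72 * k * (6 ^ (e + 2) * 6 ^ (e + 1))) * u * (p ^ (e + 2) * r ^ e)" if "p \<noteq> 0" "r \<noteq> 0" for p r k u :: real
    proof -
      have step: "(A * P) * ((B * (r * Q)) * (k * (2 * p))) * (36 * u / (p * r)) = (72 * k * (A * B)) * u * (P * Q)"
        for A B P Q :: real using that by (simp add: field_simps)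
      have r: "(6 * r) ^ (e + 1) = 6 ^ (e + 1) * (r * r ^ e)" by (simp add: power_mult_distrib)
      show ?thesis unfolding r power_mult_distrib[of 6 p] by (rule step)
    qed
    have six: "(3 * 2 ^ (m + 1) :: real) = 6 * 2 ^ m" and two: "(2 ^ (m + 1) :: real) = 2 * 2 ^ m" for m by simp_all
    have e1: "CARD('n) - 1 = e + 1" by (simp add: e)
    show ?thesis unfolding six unfolding two e1 unfolding e by (rule aux) auto
  qed
  also have "(6::real) ^ (e + 2) * 6 ^ (e + 1) = 6 ^ (2 * CARD('n) - 1)"
    unfolding power_add[symmetric] e by (rule arg_cong[of _ _ "\<lambda>k. 6 ^ k"]) simp
  also have "((2::real) ^ i) ^ (e + 2) * (2 ^ j) ^ e = 2 ^ (i * CARD('n)) * 2 ^ (j * (CARD('n) - 2))"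
  proof -
    have e2: "CARD('n) - 2 = e" by (simp add: e)
    show ?thesis unfolding e2 unfolding e power_mult by (rule refl)
  qed
  finally show "real (card (S i j)) \<le> (72 * (real CARD('n) + 1) * 6 ^ (2 * CARD('n) - 1)) * U\<^sup>2 *
      (2 ^ (i * CARD('n)) * 2 ^ (j * (CARD('n) - 2)))" .
qed

lemma finite_near_lines: "finite (near_lines U X)"
proof (cases "U \<ge> 1")
  case True
  show ?thesis unfolding near_lines_def by (rule finite_subset[OF _ card_int_vec_ball(1)[OF True]]) auto
next
  case False
  have "near_lines U X \<subseteq> {u. norm (int_vec u) \<le> 1}" using False by (auto simp: near_lines_def)
  thus ?thesis by (rule finite_subset[OF _ card_int_vec_ball(1)]) simp
qed

text \<open>With \<open>s = i + j\<close>, a shell contributes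
  \<open>U^2 * 2 ^ (s * (d - 2)) * 4 ^ i\<close>. The sum over \<open>i \<le> s div 2\<close> costs
  \<open>2 ^ s\<close>, and the remaining sum over \<open>s\<close> is geometric, dominated by
  \<open>s = J\<close> with \<open>2 ^ J \<le> 2 * X\<close>. Each of the two sums costs a factor 2,
  whence \<open>288 = 4 * 72\<close>.\<close>

lemma card_near_lines:
  assumes d: "CARD('n) \<ge> 3" and X: "X \<ge> 0"
  shows "real (card (near_lines U X :: (int ^ 'n::finite) set)) \<le>
    (288 * (real CARD('n) + 1) * 6 ^ (2 * CARD('n) - 1)) * U\<^sup>2 * (2 * X) ^ (CARD('n) - 1)"
proof (cases "2 * X \<ge> 1")
  case False
  \<comment> \<open>A positive Gram determinant of integer vectors is at least 1, so it cannot be at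
    most \<open>X^2 < 1\<close>.\<close>
  have "near_lines U X = ({} :: (int ^ 'n) set)"
  proof -
    have False if u: "u \<in> near_lines U X" for u :: "int ^ 'n"
    proof -
      obtain v where uv: "0 < gram_det (int_vec u) (int_vec v)" "gram_det (int_vec u) (int_vec v) \<le> X\<^sup>2"
        using u unfolding near_lines_def by blast
      define g where "g = (\<Sum>i\<in>UNIV. (u $ i)\<^sup>2) * (\<Sum>i\<in>UNIV. (v $ i)\<^sup>2) - (\<Sum>i\<in>UNIV. u $ i * v $ i)\<^sup>2"
      have "gram_det (int_vec u) (int_vec v) = of_int g"
        by (simp add: gram_det_def g_def inner_vec_def int_vec_def power2_eq_square)
      moreover have "X\<^sup>2 < 1\<^sup>2" using X False by (intro power_strict_mono) auto
      ultimately have "0 < real_of_int g" "real_of_int g < 1" using uv by simp_all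
      thus False by simp
    qed
    thus ?thesis by blast
  qed
  thus ?thesis using X by simp
next
  case True
  define C where "C = 72 * (real CARD('n) + 1) * 6 ^ (2 * CARD('n) - 1)"
  have C0: "C \<ge> 0" by (simp add: C_def)
  obtain e where e: "CARD('n) = e + 3" using d by (metis add.commute le_Suc_ex)
  obtain J where J: "2 ^ J \<le> 2 * X" "2 * X < 2 ^ (J + 1)" by (rule ex_power_two_bounds[OF True])
  define S where "S i j = ((\<Union>(b, c)\<in>reduced_pairs U i j. lattice_box U b c) :: (int ^ 'n) set)" for i j
  have d2: "CARD('n) \<ge> 2" using d by simp
  have finS: "finite (S i j)" for i j unfolding S_def by (rule card_reduced_lattice_boxes(1)[OF d2])
  have cardS: "real (card (S i j)) \<le> C * U\<^sup>2 * (2 ^ (i * (e + 3)) * 2 ^ (j * (e + 1)))" for i j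
    using card_reduced_lattice_boxes(2)[OF d2, of U i j] unfolding S_def C_def e by simp
  have "near_lines U X \<subseteq> (\<Union>s\<in>{..J}. \<Union>i\<in>{..s div 2}. S i (s - i))"
    unfolding S_def by (rule near_lines_subset[OF X J(2)])
  moreover have "finite (\<Union>s\<in>{..J}. \<Union>i\<in>{..s div 2}. S i (s - i))" using finS by blast
  ultimately have "card (near_lines U X :: (int ^ 'n) set) \<le> card (\<Union>s\<in>{..J}. \<Union>i\<in>{..s div 2}. S i (s - i))"
    by (intro card_mono)
  also have "\<dots> \<le> (\<Sum>s\<le>J. card (\<Union>i\<in>{..s div 2}. S i (s - i)))" by (rule card_UN_le) simp
  also have "\<dots> \<le> (\<Sum>s\<le>J. \<Sum>i\<le>s div 2. card (S i (s - i)))" by (intro sum_mono card_UN_le) simp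
  finally have "real (card (near_lines U X :: (int ^ 'n) set)) \<le> real (\<Sum>s\<le>J. \<Sum>i\<le>s div 2. card (S i (s - i)))"
    by (simp only: of_nat_le_iff)
  also have "\<dots> = (\<Sum>s\<le>J. \<Sum>i\<le>s div 2. real (card (S i (s - i))))" by simp
  also have "\<dots> \<le> (\<Sum>s\<le>J. \<Sum>i\<le>s div 2. C * U\<^sup>2 * ((2 ^ (e + 1)) ^ s * 4 ^ i))"
  proof (intro sum_mono)
    fix s i :: nat assume "i \<in> {..s div 2}"
    hence "i \<le> s" by auto
    then obtain j where s: "s = i + j" using le_Suc_ex by blast
    \<comment> \<open>The exponents satisfy
      \<open>i * (e + 3) + j * (e + 1) = (i + j) * (e + 1) + 2 * i\<close>, where
      \<open>d = e + 3\<close>.\<close>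
    have "(2::real) ^ (i * (e + 3)) * 2 ^ (j * (e + 1)) = (2 ^ (e + 1)) ^ s * (2\<^sup>2) ^ i"
      unfolding power_mult[symmetric] power_add[symmetric] s
      by (rule arg_cong[of _ _ "\<lambda>k. 2 ^ k"]) (simp add: algebra_simps)
    thus "real (card (S i (s - i))) \<le> C * U\<^sup>2 * ((2 ^ (e + 1)) ^ s * 4 ^ i)"
      using cardS[of i j] s by simp
  qed
  also have "\<dots> = C * U\<^sup>2 * (\<Sum>s\<le>J. (2 ^ (e + 1)) ^ s * (\<Sum>i\<le>s div 2. 4 ^ i))"
    by (simp add: sum_distrib_left)
  also have "\<dots> \<le> C * U\<^sup>2 * (\<Sum>s\<le>J. 2 * (2 ^ (e + 2)) ^ s)"
  proof (intro mult_left_mono sum_mono)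
    fix s
    have "(\<Sum>i\<le>s div 2. 4 ^ i) \<le> 2 * (4::real) ^ (s div 2)" by (rule sum_geometric_le) simp
    also have "(4::real) ^ (s div 2) = 2 ^ (2 * (s div 2))" by (simp add: power_mult)
    also have "\<dots> \<le> (2::real) ^ s" by (intro power_increasing) auto
    finally have "(2 ^ (e + 1)) ^ s * (\<Sum>i\<le>s div 2. 4 ^ i) \<le> (2 ^ (e + 1)) ^ s * (2 * (2::real) ^ s)"
      by (intro mult_left_mono) auto
    also have "\<dots> = 2 * (2 ^ (e + 1) * 2) ^ s" unfolding power_mult_distrib by simp
    finally show "(2 ^ (e + 1)) ^ s * (\<Sum>i\<le>s div 2. 4 ^ i) \<le> 2 * ((2::real) ^ (e + 2)) ^ s" by simp
  qed (use C0 in auto)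
  also have "\<dots> = 2 * C * U\<^sup>2 * (\<Sum>s\<le>J. (2 ^ (e + 2)) ^ s)" by (simp add: sum_distrib_left mult_ac)
  also have "\<dots> \<le> 2 * C * U\<^sup>2 * (2 * (2 ^ (e + 2)) ^ J)"
  proof -
    have "(2::real) ^ 1 \<le> 2 ^ (e + 2)" by (intro power_increasing) auto
    hence "(\<Sum>s\<le>J. ((2::real) ^ (e + 2)) ^ s) \<le> 2 * (2 ^ (e + 2)) ^ J" by (intro sum_geometric_le) simp
    from mult_left_mono[OF this, of "2 * C * U\<^sup>2"] C0 show ?thesis by simp
  qed
  also have "\<dots> = 4 * C * U\<^sup>2 * (2 ^ J) ^ (e + 2)" by (simp only: power_mult[symmetric] mult.commute[of J])
  also have "\<dots> \<le> 4 * C * U\<^sup>2 * (2 * X) ^ (e + 2)"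
    using J C0 by (intro mult_left_mono power_mono) auto
  finally have "real (card (near_lines U X :: (int ^ 'n) set)) \<le> 4 * C * U\<^sup>2 * (2 * X) ^ (e + 2)" .
  moreover have "4 * C = 288 * (real CARD('n) + 1) * 6 ^ (2 * CARD('n) - 1)" by (simp add: C_def)
  moreover have "CARD('n) - 1 = e + 2" by (simp add: e)
  ultimately show ?thesis by (simp only:)
qed

section \<open>Counting primitive vectors\<close>

lemma card_multiples_interval:
  fixes n u L :: nat
  assumes n: "n > 0"
  shows "card {t \<in> {u<..u + L}. n dvd t} \<le> L div n + 1"
proof -
  have "{t \<in> {u<..u + L}. n dvd t} \<subseteq> (*) n ` {u div n<..(u + L) div n}"
  proof
    fix t assume t: "t \<in> {t \<in> {u<..u + L}. n dvd t}"
    then obtain w where w: "t = n * w" by (auto elim: dvdE)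
    have "u div n < w" using t w n by (simp add: div_less_iff_less_mult mult.commute)
    moreover have "w \<le> (u + L) div n" using t w n by (simp add: less_eq_div_iff_mult_less_eq mult.commute)
    ultimately show "t \<in> (*) n ` {u div n<..(u + L) div n}" using w by auto
  qed
  hence "card {t \<in> {u<..u + L}. n dvd t} \<le> card ((*) n ` {u div n<..(u + L) div n})"
    by (intro card_mono) auto
  also have "\<dots> \<le> (u + L) div n - u div n" using card_image_le[of "{u div n<..(u + L) div n}" "(*) n"] by simp
  \<comment> \<open>The two remainders carry at most one extra multiple.\<close>
  also have "\<dots> \<le> L div n + 1"
  proof -
    have "(u mod n + L mod n) div n \<le> 1"
    proof -
      have "u mod n + L mod n < 2 * n" using n mod_less_divisor[of n u] mod_less_divisor[of n L] by linarith
      hence "(u mod n + L mod n) div n < 2" using n by (simp add: div_less_iff_less_mult)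
      thus ?thesis by simp
    qed
    thus ?thesis unfolding div_add1_eq[of u L n] by simp
  qed
  finally show ?thesis .
qed

text \<open>Union bound: a nonprimitive vector of the box has all entries divisible by its gcd,
  which is at least 2 and at most any entry, hence at most \<open>H\<close>.\<close>

lemma card_primitive_box_ge:
  fixes u :: "'n::finite \<Rightarrow> nat"
  assumes H: "\<And>i. u i + L \<le> H"
  defines "B \<equiv> {a :: nat ^ 'n. \<forall>i. a $ i \<in> {u i<..u i + L}}"
  shows "finite (B \<inter> primitive_vectors)"
    and "real L ^ CARD('n) - (\<Sum>n=2..H. real (L div n + 1) ^ CARD('n)) \<le> real (card (B \<inter> primitive_vectors))"
proof -
  define M where "M n = {a :: nat ^ 'n. \<forall>i. a $ i \<in> {t \<in> {u i<..u i + L}. n dvd t}}" for n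
  have finB: "finite B" unfolding B_def by (rule card_vec_box(1)) simp
  thus "finite (B \<inter> primitive_vectors)" by simp
  have finM: "finite (M n)" for n unfolding M_def by (rule card_vec_box(1)) simp
  have cardB: "card B = L ^ CARD('n)" unfolding B_def by (subst card_vec_box(2)) auto
  have cardM: "card (M n) \<le> (L div n + 1) ^ CARD('n)" if "n > 0" for n
  proof -
    have "card (M n) = (\<Prod>i\<in>UNIV. card {t \<in> {u i<..u i + L}. n dvd t})"
      unfolding M_def by (rule card_vec_box(2)) simp
    also have "\<dots> \<le> (\<Prod>i\<in>(UNIV :: 'n set). L div n + 1)"
      using card_multiples_interval[OF that] by (intro prod_mono) auto
    finally show ?thesis by simp
  qed
  have sub: "B \<subseteq> (B \<inter> primitive_vectors) \<union> (\<Union>n\<in>{2..H}. M n)"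
  proof
    fix a assume a: "a \<in> B"
    define g where "g = Gcd (range (($) a))"
    have dvd: "g dvd a $ i" for i unfolding g_def by (rule Gcd_dvd) simp
    have pos: "a $ i > 0" for i using a by (simp add: B_def) (metis gr_zeroI not_less_zero)
    show "a \<in> (B \<inter> primitive_vectors) \<union> (\<Union>n\<in>{2..H}. M n)"
    proof (cases "g = 1")
      case True
      thus ?thesis using a pos by (simp add: primitive_vectors_def g_def)
    next
      case False
      fix i
      have "g \<noteq> 0" using dvd[of i] pos[of i] by (intro notI) simp
      hence "g \<ge> 2" using False by simp
      moreover have "g \<le> H"
      proof -
        have "g \<le> a $ i" using dvd[of i] pos[of i] by (rule dvd_imp_le)
        also have "\<dots> \<le> u i + L" using a by (simp add: B_def)
        finally show ?thesis using H[of i] by simp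
      qed
      moreover have "a \<in> M g" using a dvd by (simp add: M_def B_def)
      ultimately show ?thesis by auto
    qed
  qed
  have "L ^ CARD('n) = card B" by (simp add: cardB)
  also have "\<dots> \<le> card ((B \<inter> primitive_vectors) \<union> (\<Union>n\<in>{2..H}. M n))"
    using finB finM by (intro card_mono sub) auto
  also have "\<dots> \<le> card (B \<inter> primitive_vectors) + card (\<Union>n\<in>{2..H}. M n)" by (rule card_Un_le)
  also have "card (\<Union>n\<in>{2..H}. M n) \<le> (\<Sum>n=2..H. card (M n))" by (rule card_UN_le) simp
  also have "(\<Sum>n=2..H. card (M n)) \<le> (\<Sum>n=2..H. (L div n + 1) ^ CARD('n))"
    using cardM by (intro sum_mono) auto
  finally have "L ^ CARD('n) \<le> card (B \<inter> primitive_vectors) + (\<Sum>n=2..H. (L div n + 1) ^ CARD('n))" by simp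
  hence "real (L ^ CARD('n)) \<le> real (card (B \<inter> primitive_vectors) + (\<Sum>n=2..H. (L div n + 1) ^ CARD('n)))"
    by (simp only: of_nat_le_iff)
  thus "real L ^ CARD('n) - (\<Sum>n=2..H. real (L div n + 1) ^ CARD('n)) \<le> real (card (B \<inter> primitive_vectors))"
    by simp
qed

text \<open>For \<open>n \<le> L\<close> put \<open>x = 1 / n\<close> and \<open>y = 1 / L\<close>.
  As \<open>x + y \<le> 1\<close>, the exponent can be lowered to 3, and
  \<open>(x + y) ^ 3 \<le> x^2 * (x + 7 * y) \<le> 5 / 8 * x^2\<close>, where
  \<open>L \<ge> 56\<close> makes \<open>7 * y \<le> 1 / 8\<close>. For \<open>n > L\<close> each
  term is 1, which \<open>H \<le> L ^ d / 8\<close> pays for. The inverse squares from 2 on sum to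
  at most 1, so the total is at most \<open>5 / 8 + 1 / 8\<close> times
  \<open>L ^ d\<close>.\<close>

lemma sum_multiples_power_le:
  assumes d: "d \<ge> 3" and L: "L \<ge> 56" and H: "8 * real H \<le> real L ^ 3"
  shows "(\<Sum>n=2..H. real (L div n + 1) ^ d) \<le> 3 / 4 * real L ^ d"
proof -
  define l where "l = real L"
  have l: "l \<ge> 56" using L by (simp add: l_def)
  have term_le: "real (L div n + 1) ^ d \<le> 5 / 8 * l ^ d * (if n \<le> L then 1 / (real n)\<^sup>2 else 0) + 1" if n: "n \<ge> 2" for n
  proof (cases "n \<le> L")
    case True
    define x where "x = 1 / real n"
    define y where "y = 1 / l"
    have xy: "0 < y" "y \<le> x" "x \<le> 1/2" "y \<le> 1/56" using n True l by (auto simp: x_def y_def l_def divide_simps)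
    have "real (L div n + 1) \<le> l / real n + 1" using of_nat_div_le_of_nat[of L n, where ?'a = real] by (simp add: l_def)
    also have "\<dots> = l * (x + y)" using l by (simp add: x_def y_def field_simps)
    finally have "real (L div n + 1) ^ d \<le> (l * (x + y)) ^ d" by (intro power_mono) auto
    also have "\<dots> = l ^ d * (x + y) ^ d" by (rule power_mult_distrib)
    also have "(x + y) ^ d \<le> (x + y) ^ 3" using xy d by (intro power_decreasing) auto
    also have "(x + y) ^ 3 \<le> 5 / 8 * x\<^sup>2"
    proof -
      have "(x + y) ^ 3 = x\<^sup>2 * (x + 3 * y) + y\<^sup>2 * (3 * x + y)"
        by (simp add: power2_eq_square power3_eq_cube algebra_simps)
      also have "y\<^sup>2 * (3 * x + y) \<le> y\<^sup>2 * (4 * x)" using xy by (intro mult_left_mono) auto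
      also have "y\<^sup>2 * (4 * x) = (4 * y) * (x * y)" by (simp add: power2_eq_square)
      also have "\<dots> \<le> (4 * y) * (x * x)" using xy by (intro mult_left_mono) auto
      also have "x\<^sup>2 * (x + 3 * y) + (4 * y) * (x * x) = x\<^sup>2 * (x + 7 * y)"
        by (simp add: power2_eq_square algebra_simps)
      also have "\<dots> \<le> x\<^sup>2 * (5 / 8)" using xy by (intro mult_left_mono) auto
      finally show ?thesis by simp
    qed
    finally have "real (L div n + 1) ^ d \<le> l ^ d * (5 / 8 * x\<^sup>2)" using l by simp
    thus ?thesis using True by (simp add: x_def power_divide mult_ac)
  qed simp
  have "(\<Sum>n=2..H. real (L div n + 1) ^ d) \<le> (\<Sum>n=2..H. 5 / 8 * l ^ d * (if n \<le> L then 1 / (real n)\<^sup>2 else 0) + 1)"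
    using term_le by (intro sum_mono) auto
  also have "\<dots> \<le> 5 / 8 * l ^ d * (\<Sum>n=2..H. if n \<le> L then 1 / (real n)\<^sup>2 else 0) + real H"
    by (simp add: sum.distrib sum_distrib_left)
  also have "(\<Sum>n=2..H. if n \<le> L then 1 / (real n)\<^sup>2 else 0) \<le> 1"
  proof -
    have "(\<Sum>n=2..H. if n \<le> L then 1 / (real n)\<^sup>2 else 0) = (\<Sum>n\<in>{2..H} \<inter> {n. n \<le> L}. 1 / (real n)\<^sup>2)"
      by (simp add: sum.inter_restrict[symmetric] sum.inter_filter[symmetric] Int_def)
    also have "\<dots> \<le> (\<Sum>n=2..L. 1 / (real n)\<^sup>2)" by (intro sum_mono2) auto
    also have "\<dots> = (\<Sum>n=1..L. 1 / (real n)\<^sup>2) - 1"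
      using L by (subst sum.atLeast_Suc_atMost[of 1 L]) (auto simp: numeral_2_eq_2)
    also have "\<dots> \<le> 1" using sum_inverse_squares_le[of L] by (simp add: diff_le_eq order_trans)
    finally show ?thesis .
  qed
  also have "real H \<le> l ^ d / 8"
  proof -
    have "l ^ 3 \<le> l ^ d" using l d by (intro power_increasing) auto
    thus ?thesis using H by (simp add: l_def)
  qed
  finally show ?thesis using l by (simp add: l_def)
qed

section \<open>Primitive points in dilates of \<open>D\<close>\<close>

lemma norm_primitive_point_le:
  assumes "a \<in> primitive_points D T" "T > 0" "bounded D"
  shows "norm (real_vec a) \<le> T * (SUP x\<in>D. norm x)"
proof -
  obtain x where x: "x \<in> D" "real_vec a = T *\<^sub>R x" using assms(1) by (auto simp: primitive_points_def)
  have "bdd_above (norm ` D)" using assms(3) by (simp add: bounded_imp_bdd_above bounded_norm_comp)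
  hence "norm x \<le> (SUP x\<in>D. norm x)" using x(1) by (rule cSUP_upper[rotated])
  thus ?thesis using x(2) assms(2) by simp
qed

lemma finite_real_vec_ball: "finite {a :: nat ^ 'n::finite. norm (real_vec a) \<le> B}"
proof (rule finite_subset)
  show "{a :: nat ^ 'n. norm (real_vec a) \<le> B} \<subseteq> {a. \<forall>i. a $ i \<in> {..nat \<lfloor>B\<rfloor>}}"
  proof (intro subsetI CollectI allI)
    fix a :: "nat ^ 'n" and i
    assume "a \<in> {a. norm (real_vec a) \<le> B}"
    moreover have "real (a $ i) \<le> norm (real_vec a)"
      using component_le_norm_cart[of "real_vec a" i] by (simp add: real_vec_def)
    ultimately have "real (a $ i) \<le> B" by simp
    thus "a $ i \<in> {..nat \<lfloor>B\<rfloor>}" by (simp add: le_nat_floor)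
  qed
  show "finite {a :: nat ^ 'n. \<forall>i. a $ i \<in> {..nat \<lfloor>B\<rfloor>}}" by (rule card_vec_box(1)) simp
qed

lemma finite_primitive_points:
  assumes "T > 0" "bounded D"
  shows "finite (primitive_points D T)"
  using norm_primitive_point_le[OF _ assms] by (intro finite_subset[OF _ finite_real_vec_ball]) blast

text \<open>\<open>D\<close> contains a cube around an interior point, so its dilate contains an
  integer box of side about \<open>\<eta> * T\<close> with entries \<open>O(T)\<close>; the sieve
  removes at most three quarters of that box.\<close>

lemma card_primitive_points_ge:
  fixes D :: "(real ^ 'n::finite) set"
  assumes d: "CARD('n) \<ge> 3" and nonneg: "D \<subseteq> {x. \<forall>i. 0 \<le> x $ i}" and bdd: "bounded D"
    and int: "interior D \<noteq> {}"
  obtains c T0 where "c > 0" "T0 > 0"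
    "\<And>T. T \<ge> T0 \<Longrightarrow> c * T ^ CARD('n) \<le> real (card (primitive_points D T))"
proof -
  obtain x where "x \<in> interior D" using int by blast
  then obtain \<epsilon> where \<epsilon>: "\<epsilon> > 0" "ball x \<epsilon> \<subseteq> D" unfolding mem_interior by blast
  define \<eta> where "\<eta> = \<epsilon> / (2 * real CARD('n))"
  have \<eta>: "\<eta> > 0" using \<epsilon> d by (simp add: \<eta>_def)
  have cube: "y \<in> D" if y: "\<And>i. \<bar>y $ i - x $ i\<bar> \<le> \<eta>" for y
  proof -
    have "dist x y = norm (y - x)" by (simp add: dist_norm norm_minus_commute)
    also have "\<dots> \<le> (\<Sum>i\<in>UNIV. \<bar>(y - x) $ i\<bar>)" by (rule norm_le_l1_cart)
    also have "\<dots> \<le> (\<Sum>i\<in>(UNIV :: 'n set). \<eta>)" using y by (intro sum_mono) simp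
    also have "\<dots> = \<epsilon> / 2" using d by (simp add: \<eta>_def)
    finally show ?thesis using \<epsilon> by (auto simp: subset_iff)
  qed
  have x0: "x $ i \<ge> 0" for i using cube[of x] \<eta> nonneg by auto
  \<comment> \<open>\<open>K\<close> is chosen so that every entry of the box is at most
    \<open>K * L\<close>, and \<open>T0\<close> so that \<open>L \<ge> 56 + 8 * K\<close>, which
    meets both size conditions of the sieve bound.\<close>
  define K where "K = 2 * norm x / \<eta> + 1"
  have K1: "K \<ge> 1" using \<eta> by (simp add: K_def)
  define T0 where "T0 = 2 * (56 + 8 * K) / \<eta>"
  define c where "c = (\<eta> / 2) ^ CARD('n) / 4"
  show ?thesis
  proof (rule that)
    show "c > 0" using \<eta> by (simp add: c_def)
    show "T0 > 0" using \<eta> K1 by (simp add: T0_def)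
    fix T assume T: "T \<ge> T0"
    define L where "L = nat \<lfloor>\<eta> * T\<rfloor>"
    define u where "u i = nat \<lfloor>T * x $ i\<rfloor>" for i
    define H where "H = nat \<lfloor>K * real L\<rfloor>"
    have \<eta>T: "\<eta> * T \<ge> 2 * (56 + 8 * K)"
      using T \<eta> by (simp add: T0_def pos_divide_le_eq mult.commute)
    have T0: "T > 0" using T \<open>T0 > 0\<close> by linarith
    have L: "real L \<le> \<eta> * T" "\<eta> * T / 2 \<le> real L"
      using \<eta>T K1 real_nat_floor_ge_half[of "\<eta> * T"] by (auto simp: L_def)
    have "56 + 8 * K \<le> \<eta> * T / 2" using \<eta>T by simp
    hence L56: "real L \<ge> 56 + 8 * K" using L(2) by (rule order_trans)
    have u: "real (u i) \<le> T * x $ i" "T * x $ i < real (u i) + 1" for i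
      using x0[of i] T0 by (auto simp: u_def)
    have H: "u i + L \<le> H" for i
    proof -
      have "real (u i) \<le> T * norm x"
        using u(1)[of i] component_le_norm_cart[of x i] x0[of i] T0
        by (meson abs_le_D1 mult_left_mono order_less_imp_le order_trans)
      also have "\<dots> \<le> (2 * real L / \<eta>) * norm x"
        using L(2) \<eta> by (intro mult_right_mono) (auto simp: field_simps)
      also have "\<dots> = (K - 1) * real L" by (simp add: K_def)
      finally have "real (u i + L) \<le> K * real L" by (simp add: algebra_simps)
      thus ?thesis unfolding H_def by (rule le_nat_floor)
    qed
    let ?B = "{a :: nat ^ 'n. \<forall>i. a $ i \<in> {u i<..u i + L}}"
    have "8 * real H \<le> real L ^ 3"
    proof -
      have "real H \<le> K * real L" using K1 by (simp add: H_def)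
      hence "8 * real H \<le> (8 * K) * real L * 1" by simp
      also have "\<dots> \<le> real L * real L * real L" using L56 K1 by (intro mult_mono) auto
      finally show ?thesis by (simp add: power3_eq_cube)
    qed
    moreover have "L \<ge> 56" using L56 K1 by linarith
    ultimately have "(\<Sum>n=2..H. real (L div n + 1) ^ CARD('n)) \<le> 3 / 4 * real L ^ CARD('n)"
      using sum_multiples_power_le[OF d] by blast
    hence "real L ^ CARD('n) / 4 \<le> real (card (?B \<inter> primitive_vectors))"
      using card_primitive_box_ge(2)[of u L H, OF H] by linarith
    moreover have "?B \<inter> primitive_vectors \<subseteq> primitive_points D T"
    proof
      fix a assume a: "a \<in> ?B \<inter> primitive_vectors"
      have mem: "(1 / T) *\<^sub>R real_vec a \<in> D"
      proof (rule cube)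
        fix i
        \<comment> \<open>With \<open>u\<close> the floor of \<open>T * x\<close>, the half-open box
          lies between \<open>T * x\<close> and \<open>T * x + \<eta> * T\<close> in each
          coordinate.\<close>
        have "u i + 1 \<le> a $ i" "a $ i \<le> u i + L" using a by (simp_all add: Suc_le_eq)
        hence "real (u i) + 1 \<le> real (a $ i)" "real (a $ i) \<le> real (u i) + real L" by linarith+
        hence "\<bar>real (a $ i) - T * x $ i\<bar> \<le> T * \<eta>" using u[of i] L(1) by (simp add: mult.commute abs_le_iff)
        moreover have "((1 / T) *\<^sub>R real_vec a) $ i - x $ i = (real (a $ i) - T * x $ i) / T"
          using T0 by (simp add: real_vec_def field_simps)
        ultimately show "\<bar>((1 / T) *\<^sub>R real_vec a) $ i - x $ i\<bar> \<le> \<eta>"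
          using T0 by (simp add: pos_divide_le_eq mult.commute)
      qed
      have "real_vec a = T *\<^sub>R ((1 / T) *\<^sub>R real_vec a)" using T0 by simp
      hence "real_vec a \<in> (\<lambda>x. T *\<^sub>R x) ` D" using mem by (rule image_eqI)
      thus "a \<in> primitive_points D T" using a by (simp add: primitive_points_def)
    qed
    hence "card (?B \<inter> primitive_vectors) \<le> card (primitive_points D T)"
      by (intro card_mono finite_primitive_points T0 bdd)
    moreover have "c * T ^ CARD('n) \<le> real L ^ CARD('n) / 4"
    proof -
      have "(\<eta> / 2 * T) ^ CARD('n) \<le> real L ^ CARD('n)" using L(2) \<eta> T0 by (intro power_mono) auto
      hence "(\<eta> / 2) ^ CARD('n) * T ^ CARD('n) \<le> real L ^ CARD('n)" by (simp only: power_mult_distrib)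
      thus ?thesis unfolding c_def by simp
    qed
    ultimately show "c * T ^ CARD('n) \<le> real (card (primitive_points D T))" by linarith
  qed
qed

section \<open>The tail bound\<close>

lemma tail_prob_le_one:
  assumes "T > 0" "bounded D"
  shows "tail_prob D T R \<le> 1"
proof -
  have "card {a \<in> primitive_points D T. real_of_int (frobenius_f a) / frobenius_s a > R} \<le> card (primitive_points D T)"
    by (intro card_mono finite_primitive_points assms) auto
  thus ?thesis unfolding tail_prob_def by (intro divide_le_eq_1[THEN iffD2]) auto
qed

lemma tail_prob_eq_0:
  fixes D :: "(real ^ 'n::finite) set"
  assumes d: "CARD('n) \<ge> 2" and D: "bounded D" and T: "T > 0"
    and R: "R \<ge> (T * (SUP x\<in>D. norm x)) powr (1 - 1 / (real CARD('n) - 1))"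
  shows "tail_prob D T R = 0"
proof -
  have "\<not> real_of_int (frobenius_f a) / frobenius_s a > R" if a: "a \<in> primitive_points D T" for a
  proof -
    have prim: "a \<in> primitive_vectors" using a by (simp add: primitive_points_def)
    have "real_of_int (frobenius_f a) / frobenius_s a \<le> norm (real_vec a) powr (1 - 1 / (real CARD('n) - 1))"
      using frobenius_f_le_s[OF prim d] frobenius_s_pos[OF prim d] by (simp add: pos_divide_le_eq mult.commute)
    also have "\<dots> \<le> (T * (SUP x\<in>D. norm x)) powr (1 - 1 / (real CARD('n) - 1))"
      using d norm_primitive_point_le[OF a T D] by (intro powr_mono2) (auto simp: divide_simps)
    finally show ?thesis using R by linarith
  qed
  hence empty: "{a \<in> primitive_points D T. real_of_int (frobenius_f a) / frobenius_s a > R} = {}" by blast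
  show ?thesis unfolding tail_prob_def empty by simp
qed

text \<open>The vectors counted inject into \<open>near_lines U X\<close>, and the powers combine to
  \<open>U^2 * (U powr (1 - 1 / n)) ^ n = U ^ d\<close> because \<open>n = d - 1\<close>.\<close>

lemma card_large_frobenius_le:
  fixes D :: "(real ^ 'n::finite) set"
  defines "n \<equiv> real CARD('n) - 1"
  assumes d: "CARD('n) \<ge> 3" and D: "bounded D" and T: "T > 0" and ne: "primitive_points D T \<noteq> {}"
    and R: "R \<ge> 2 * n * sqrt (real CARD('n))"
  shows "real (card {a \<in> primitive_points D T. real_of_int (frobenius_f a) / frobenius_s a > R}) \<le>
    288 * (real CARD('n) + 1) * 6 ^ (2 * CARD('n) - 1) * (64 * n ^ 3 * sqrt (real CARD('n))) ^ (CARD('n) - 1) *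
      (T * (SUP x\<in>D. norm x)) ^ CARD('n) / R ^ (CARD('n) - 1)"
proof -
  define U where "U = T * (SUP x\<in>D. norm x)"
  define K where "K = 32 * n ^ 3 * sqrt (real CARD('n))"
  define X where "X = K * U powr (1 - 1 / n) / R"
  define bad where "bad = {a \<in> primitive_points D T. real_of_int (frobenius_f a) / frobenius_s a > R}"
  obtain e where e: "CARD('n) = e + 2" "e \<ge> 1"
    using d by (intro that[of "CARD('n) - 2"]) auto
  have n: "n = real e + 1" by (simp add: n_def e)
  have n2: "n \<ge> 2" using e by (simp add: n)
  have "2 * n * sqrt (real CARD('n)) > 0" using n2 by simp
  hence R0: "R > 0" using R by linarith
  have K0: "K \<ge> 0" using n2 by (simp add: K_def)
  have U1: "U \<ge> 1"
  proof -
    obtain a where a: "a \<in> primitive_points D T" using ne by blast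
    hence "norm (real_vec a) \<ge> 1" by (intro norm_real_vec_ge_one) (simp add: primitive_points_def)
    thus ?thesis using norm_primitive_point_le[OF a T D] unfolding U_def by linarith
  qed
  define emb where "emb a = (\<chi> i. int (a $ i))" for a :: "nat ^ 'n"
  have emb: "int_vec (emb a) = real_vec a" for a by (simp add: emb_def int_vec_def real_vec_def)
  have inj: "inj_on emb bad" by (auto simp: inj_on_def emb_def vec_eq_iff)
  have "emb ` bad \<subseteq> near_lines U X"
  proof
    fix v assume "v \<in> emb ` bad"
    then obtain a where a: "v = emb a" "a \<in> primitive_points D T" "real_of_int (frobenius_f a) / frobenius_s a > R"
      by (auto simp: bad_def)
    have prim: "a \<in> primitive_vectors" using a(2) by (simp add: primitive_points_def)
    have aU: "norm (real_vec a) \<le> U" unfolding U_def by (rule norm_primitive_point_le[OF a(2) T D])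
    obtain m where m: "0 < gram_det (real_vec a) (int_vec m)" "norm (int_vec m) \<le> norm (real_vec a)"
      "gram_det (real_vec a) (int_vec m) \<le> (K * norm (real_vec a) powr (1 - 1 / n) / R)\<^sup>2"
      using large_frobenius_near_integer_line[OF prim _ R[unfolded n_def] a(3)] d unfolding K_def n_def by auto
    note m(3)
    also have "(K * norm (real_vec a) powr (1 - 1 / n) / R)\<^sup>2 \<le> X\<^sup>2"
      unfolding X_def using K0 R0 n2 aU by (intro power_mono divide_right_mono mult_left_mono powr_mono2) auto
    finally show "v \<in> near_lines U X"
      using m aU unfolding near_lines_def a(1) by (auto simp: emb intro!: exI[of _ m])
  qed
  hence "card bad \<le> card (near_lines U X :: (int ^ 'n) set)"
    using inj finite_near_lines by (metis card_image card_mono)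
  hence "real (card bad) \<le> real (card (near_lines U X :: (int ^ 'n) set))" by simp
  also have "\<dots> \<le> (288 * (real CARD('n) + 1) * 6 ^ (2 * CARD('n) - 1)) * U\<^sup>2 * (2 * X) ^ (CARD('n) - 1)"
    by (rule card_near_lines[OF d]) (use K0 R0 in \<open>simp add: X_def\<close>)
  also have "\<dots> = (288 * (real CARD('n) + 1) * 6 ^ (2 * CARD('n) - 1)) * (U\<^sup>2 * (2 * X) ^ (CARD('n) - 1))"
    by (rule mult.assoc)
  also have "U\<^sup>2 * (2 * X) ^ (CARD('n) - 1) = (2 * K) ^ (CARD('n) - 1) * U ^ CARD('n) / R ^ (CARD('n) - 1)"
  proof -
    have "(U powr (1 - 1 / n)) ^ (e + 1) = U powr ((1 - 1 / n) * real (e + 1))"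
      using powr_realpow[of "U powr (1 - 1 / n)" "e + 1"] U1 by (simp only: powr_powr) simp
    also have "(1 - 1 / n) * real (e + 1) = real e" by (simp add: n field_simps)
    also have "U powr real e = U ^ e" using U1 by (intro powr_realpow) simp
    finally have pw: "(U powr (1 - 1 / n)) ^ (e + 1) = U ^ e" .
    have e1: "CARD('n) - 1 = e + 1" by (simp add: e)
    have "2 * X = 2 * K * U powr (1 - 1 / n) / R" by (simp add: X_def)
    hence "(2 * X) ^ (e + 1) = (2 * K) ^ (e + 1) * U ^ e / R ^ (e + 1)"
      by (simp only: power_divide power_mult_distrib[of "2 * K"] pw)
    thus ?thesis unfolding e1 unfolding e(1) by (simp add: power2_eq_square)
  qed
  finally have "real (card bad) \<le> 288 * (real CARD('n) + 1) * 6 ^ (2 * CARD('n) - 1) *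
      (2 * K) ^ (CARD('n) - 1) * U ^ CARD('n) / R ^ (CARD('n) - 1)"
    by (simp only: mult.assoc times_divide_eq_right)
  moreover have "2 * K = 64 * n ^ 3 * sqrt (real CARD('n))" by (simp add: K_def)
  ultimately show ?thesis unfolding bad_def U_def by (simp only:)
qed

theorem theorem3:
  fixes D :: "(real ^ 'n::finite) set"
  assumes "CARD('n) \<ge> 3"
    and "D \<subseteq> {x. \<forall>i. 0 \<le> x $ i}"
    and "bounded D"
    and "interior D \<noteq> {}"
  shows "(\<exists>C>0. \<forall>T R. T > 0 \<and> primitive_points D T \<noteq> {} \<and> R > 0 \<longrightarrow>
             tail_prob D T R \<le> C * R powr - (real CARD('n) - 1))
       \<and> (\<forall>T R. T > 0 \<and> primitive_points D T \<noteq> {} \<and> R > 0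
             \<and> R \<ge> (T * (SUP x\<in>D. norm x)) powr (1 - 1 / (real CARD('n) - 1)) \<longrightarrow>
             tail_prob D T R = 0)"
proof (intro conjI allI impI)
  fix T R
  assume "T > 0 \<and> primitive_points D T \<noteq> {} \<and> R > 0 \<and>
    R \<ge> (T * (SUP x\<in>D. norm x)) powr (1 - 1 / (real CARD('n) - 1))"
  thus "tail_prob D T R = 0" using assms(1,3) by (intro tail_prob_eq_0) auto
next
  define m where "m = CARD('n) - 1"
  define n where "n = real CARD('n) - 1"
  define B where "B = (SUP x\<in>D. norm x)"
  obtain c T0 where c: "c > 0" "T0 > 0"
    "\<And>T. T \<ge> T0 \<Longrightarrow> c * T ^ CARD('n) \<le> real (card (primitive_points D T))"
    using card_primitive_points_ge[OF assms] by metis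
  define R0 where "R0 = 2 * n * sqrt (real CARD('n))"
  define R1 where "R1 = (T0 * B) powr (1 - 1 / n)"
  define G where "G = 288 * (real CARD('n) + 1) * 6 ^ (2 * CARD('n) - 1) * (64 * n ^ 3 * sqrt (real CARD('n))) ^ m"
  \<comment> \<open>The terms \<open>R0 ^ m\<close> and \<open>R1 ^ m\<close> make
    \<open>C / R ^ m \<ge> 1\<close> for \<open>R\<close> up to either threshold, where the trivial
    bound 1 suffices; the last term comes from the quotient of the two counts, and the 1 ensures
    positivity.\<close>
  define C where "C = 1 + R0 ^ m + R1 ^ m + \<bar>G * B ^ CARD('n) / c\<bar>"
  have n: "n = real m" "n \<ge> 2" using assms(1) by (simp_all add: n_def m_def)
  have R01: "R0 \<ge> 0" "R1 \<ge> 0" using n by (simp_all add: R0_def R1_def)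
  have C0: "C > 0" unfolding C_def using R01 by (simp add: add_pos_nonneg)
  have C_ge: "R0 ^ m \<le> C" "R1 ^ m \<le> C" "G * B ^ CARD('n) / c \<le> C"
    using R01 zero_le_power[of R0 m] zero_le_power[of R1 m] unfolding C_def by linarith+
  have small: "tail_prob D T R \<le> C / R ^ m" if "T > 0" "R > 0" "R \<le> R'" "R' ^ m \<le> C" for T R R' :: real
  proof -
    have "R ^ m \<le> C" using power_mono[of R R' m] that by simp
    hence "1 \<le> C / R ^ m" using that by simp
    thus ?thesis using tail_prob_le_one[OF that(1) assms(3), of R] by linarith
  qed
  have main: "tail_prob D T R \<le> C / R ^ m" if T: "T > 0" "primitive_points D T \<noteq> {}" and R: "R > 0" for T R :: real
  proof -
    \<comment> \<open>For \<open>T < T0\<close> there is no lower count, but \<open>R > R1\<close>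
      then lies above the vanishing threshold of every such \<open>T\<close>; for
      \<open>T \<ge> T0\<close> the upper and lower counts are compared.\<close>
    consider "R \<le> R0" | "R \<le> R1" | "R > R0" "R > R1" "T < T0" | "R > R0" "T \<ge> T0" by linarith
    thus ?thesis
    proof cases
      case 1
      thus ?thesis using small T R C_ge by blast
    next
      case 2
      thus ?thesis using small T R C_ge by blast
    next
      case 3
      obtain a where a: "a \<in> primitive_points D T" using T by blast
      have TB: "0 \<le> T * B" using norm_primitive_point_le[OF a T(1) assms(3)] norm_ge_zero[of "real_vec a"]
        unfolding B_def by linarith
      hence "0 \<le> B" using T(1) by (simp add: zero_le_mult_iff)
      hence "(T * B) powr (1 - 1 / n) \<le> R1"
        unfolding R1_def using TB 3 n by (intro powr_mono2 mult_right_mono) auto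
      hence "tail_prob D T R = 0"
        using 3 T assms(1,3) by (intro tail_prob_eq_0) (auto simp: B_def n_def)
      thus ?thesis using C0 R by simp
    next
      case 4
      have p: "0 < c * T ^ CARD('n)" using c T by simp
      have "tail_prob D T R \<le> (G * (T * B) ^ CARD('n) / R ^ m) / (c * T ^ CARD('n))"
        unfolding tail_prob_def
      proof (rule frac_le)
        show "real (card {a \<in> primitive_points D T. R < real_of_int (frobenius_f a) / frobenius_s a}) \<le> G * (T * B) ^ CARD('n) / R ^ m"
          using card_large_frobenius_le[OF assms(1,3) T, of R] 4(1) by (simp add: G_def B_def m_def n_def R0_def)
        show "c * T ^ CARD('n) \<le> real (card (primitive_points D T))" by (rule c(3)[OF 4(2)])
        show "0 \<le> G * (T * B) ^ CARD('n) / R ^ m"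
          using card_large_frobenius_le[OF assms(1,3) T, of R] 4(1)
          by (intro order_trans[OF of_nat_0_le_iff]) (auto simp: G_def B_def m_def n_def R0_def)
      qed (use p in auto)
      \<comment> \<open>The powers \<open>T ^ d\<close> of the two counts cancel, which makes the
        constant independent of \<open>T\<close>.\<close>
      also have "\<dots> = (G * B ^ CARD('n) / c) / R ^ m" using T c by (simp add: power_mult_distrib)
      also have "\<dots> \<le> C / R ^ m" using C_ge R by (intro divide_right_mono) auto
      finally show ?thesis .
    qed
  qed
  show "\<exists>C>0. \<forall>T R. T > 0 \<and> primitive_points D T \<noteq> {} \<and> R > 0 \<longrightarrow>
      tail_prob D T R \<le> C * R powr - (real CARD('n) - 1)"
  proof (intro exI[of _ C] conjI C0 allI impI)
    fix T R :: real assume TR: "T > 0 \<and> primitive_points D T \<noteq> {} \<and> R > 0"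
    have "R powr - (real CARD('n) - 1) = 1 / R ^ m"
      using TR n(1) by (simp add: n_def[symmetric] powr_minus powr_realpow divide_inverse)
    thus "tail_prob D T R \<le> C * R powr - (real CARD('n) - 1)" using main TR by simp
  qed
qed

end
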